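(* Let $\Delta\subset N_{\mathbb R}$ be a complete fan and let $\mathfrak E$ be a tropical bundle of rank $r$ on $\Delta$ with piecewise linear map $\Phi:|\Delta|\to\operatorname{Berg}(\mathrm M)$. Suppose $\mathfrak E$ has trivial Chern class and affinely independent (global equivariant) Chern roots $\boldsymbol u=\{u_1,\dots,u_r\}$. Let $\Xi=\Xi(\mathfrak E)$ be the coarsening of the permutohedral fan $\Sigma_r$ constructed from $\mathfrak E$ as described in the context. Then the tropical bundle $\mathfrak E$ is trivial if and only if the fan $\Xi$ is trivial.
   Context: **Fans.** $N$ is a lattice with dual $M$; fans are rational polyhedral fans, possibly with nonzero lineality space. A fan is trivial if it is comprised of a single linear space. The permutohedral fan $\Sigma_r\subset\mathbb R^r/\mathbb R\boldsymbol 1$ is the fan cut out by all hyperplanes $x_i-x_j=0$, $i<j$; its cones are $C(\mathcal W)=\operatorname{cone}(e_{W^1},\dots,e_{W^{k-1}})+\mathbb R\boldsymbol 1$ for flags $\mathcal W:\varnothing\subset W^1\subset\dots\subset W^k=[r]$ of subsets of $[r]$, and it is the normal fan of the permutohedron $\Pi_r=\sum_{i<j}[e_i,e_j]$. Vertices of $\Pi_r$ correspond to full flags, edges to pairs of full flags differing in exactly one set. **Bergman fan.** Let $\mathrm M$ be a loopless matroid of rank $r$ on $\mathrm E$, with closure $\operatorname{cl}_{\mathrm M}$. $\operatorname{Berg}(\mathrm M)\subset\mathbb R^{\mathrm E}$ consists of the cones $\operatorname{cone}(e_{F^1},\dots,e_{F^{k-1}})+\mathbb R\boldsymbol 1$ for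 flags of flats $\varnothing\subset F^1\subset\dots\subset F^k=\mathrm E$. For a basis $B$ of $\mathrm M$, $\phi_B:\mathbb R^B\cong\mathbb R^r\to\operatorname{Berg}(\mathrm M)$ is given by $\phi_B(w)_i=w_i$ if $i\in B$ and $\phi_B(w)_i=\min\{w_j\mid j\in C_i(B)\setminus i\}$ otherwise, $C_i(B)$ being the fundamental circuit of $i$ with respect to $B$. It is a PL isomorphism onto its image with inverse the coordinate projection $\pi_B$. **Tropical bundles.** A tropical bundle $\mathfrak E$ of rank $r$ on $\Delta$ is given by a map $\Phi:|\Delta|\to\operatorname{Berg}(\mathrm M)$ such that for each $\delta\in\Delta$ there exist an (ordered) basis $B_\delta$ of $\mathrm M$ and an integral linear map $T_\delta:\operatorname{span}|\delta|\to\mathbb R^r$ with $\Phi|_\delta=\phi_{B_\delta}\circ T_\delta$. It is trivial if there is a single basis $B$ of $\mathrm M$ and characters $u_1,\dots,u_r\in M$ with $\Phi=\phi_B\circ(u_1,\dots,u_r)$ on all of $|\Delta|$. The $i$-th equivariant Chern class is the piecewise polynomial function given on each $\delta$ by $\epsilon_i\circ\pi_{B_\delta}\circ\Phi|_\delta$ ($\epsilon_i$ elementary symmetric). $\mathfrak E$ has trivial Chern class if $1+c_1^T+\dots+c_r^T$ is globally polynomial; for complete $\Delta$ this is equivalent to the existence of a global multiset of equivariant Chern roots $\boldsymbol u=\{u_1,\dots,u_r\}\subset M$, i.e. $T_\delta=T|_{\operatorname{span}|\delta|}$ with $T=(u_1,\dots,u_r)$ for every $\delta$, after suitably ordering $B_\delta$.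 **Construction of $\Xi$.** For $x\in N_{\mathbb R}$ let $\lambda_1>\dots>\lambda_k$ be the distinct values of $\langle u_j,x\rangle$, $j\in[r]$, and let $\mathcal W_x$ be the flag with $W^i=\{j\in[r]\mid\langle u_j,x\rangle\ge\lambda_i\}$. Since $\boldsymbol u$ is affinely independent, every flag $\mathcal W$ of subsets of $[r]$ equals $\mathcal W_x$ for some $x$. For a full flag $\mathcal W=\mathcal W_x$, choose $\delta\in\Delta$ containing $x$ with ordered basis $B_\delta=(b_1,\dots,b_r)$ satisfying $\Phi|_\delta=\phi_{B_\delta}\circ T|_\delta$, and let $F(\mathcal W)$ be the flag of flats with $F(\mathcal W)^i=\operatorname{cl}_{\mathrm M}\{b_j\mid j\in W^i\}$; this is independent of the choices. Let $\mathcal E(F)$ be the set of edges $(\mathcal W,\mathcal W')$ of $\Pi_r$ for which there is an ordered basis $(b_1,\dots,b_r)$ of $\mathrm M$ with $F(\mathcal W)^i=\operatorname{cl}_{\mathrm M}(b_j\mid j\in W^i)$ and $F(\mathcal W')^i=\operatorname{cl}_{\mathrm M}(b_j\mid j\in (W')^i)$ for all $0\le i\le r$. Then $\Xi$ is the complete fan coarsening $\Sigma_r$ whose maximal cones are the unions of the maximal cones $C(\mathcal W)$ of $\Sigma_r$ over the classes of vertices of $\Pi_r$ connected by edges in $\mathcal E(F)$. *)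

theory Defs
  imports "HOL-Analysis.Analysis"
begin

section \<open>Lattices and fans\<close>

text \<open>
  A lattice is given inside a Euclidean space, not necessarily with full rank, so that
  its associated real vector space is \<open>span N\<close> and lattices of every rank (also \<open>0\<close>) occur.
  Characters are represented by vectors of \<open>span N\<close> through the inner product.
\<close>

definition is_lattice :: "'a::euclidean_space set \<Rightarrow> bool" where
  "is_lattice N \<longleftrightarrow>
     (\<exists>B. independent B \<and> N = {\<Sum>b\<in>B. of_int (c b) *\<^sub>R b | c :: 'a \<Rightarrow> int. True})"

definition dual_lattice :: "'a::euclidean_space set \<Rightarrow> 'a set" where
  "dual_lattice N = {u \<in> span N. \<forall>x\<in>N. u \<bullet> x \<in> \<int>}"

text \<open>Cones may contain lines, and the empty face of a cone is not a cone of the fan.\<close>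

definition rational_cone :: "'a::euclidean_space set \<Rightarrow> 'a set \<Rightarrow> bool" where
  "rational_cone N C \<longleftrightarrow> (\<exists>S. finite S \<and> S \<subseteq> N \<and> C = convex_cone hull S)"

definition is_fan :: "'a::euclidean_space set \<Rightarrow> 'a set set \<Rightarrow> bool" where
  "is_fan N \<Delta> \<longleftrightarrow> finite \<Delta> \<and> \<Delta> \<noteq> {} \<and>
     (\<forall>\<delta>\<in>\<Delta>. rational_cone N \<delta>) \<and>
     (\<forall>\<delta>\<in>\<Delta>. \<forall>\<tau>. \<tau> face_of \<delta> \<and> \<tau> \<noteq> {} \<longrightarrow> \<tau> \<in> \<Delta>) \<and>
     (\<forall>\<delta>\<in>\<Delta>. \<forall>\<delta>'\<in>\<Delta>. \<delta> \<inter> \<delta>' face_of \<delta> \<and> \<delta> \<inter> \<delta>' face_of \<delta>')"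

definition complete_fan :: "'a::euclidean_space set \<Rightarrow> 'a set set \<Rightarrow> bool" where
  "complete_fan N \<Delta> \<longleftrightarrow> is_fan N \<Delta> \<and> \<Union>\<Delta> = span N"

definition trivial_fan :: "'a::euclidean_space set set \<Rightarrow> bool" where
  "trivial_fan \<Sigma> \<longleftrightarrow> (\<exists>L. subspace L \<and> \<Sigma> = {L})"


section \<open>Matroids\<close>

text \<open>A matroid is given by its independent sets; its ground set is the finite type \<open>'e\<close>.\<close>

definition is_matroid :: "'e::finite set set \<Rightarrow> bool" where
  "is_matroid I \<longleftrightarrow> {} \<in> I \<and> (\<forall>X\<in>I. \<forall>Y\<subseteq>X. Y \<in> I) \<and>
     (\<forall>X\<in>I. \<forall>Y\<in>I. card X < card Y \<longrightarrow> (\<exists>e\<in>Y - X. insert e X \<in> I))"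

definition loopless :: "'e::finite set set \<Rightarrow> bool" where
  "loopless I \<longleftrightarrow> (\<forall>e. {e} \<in> I)"

definition rk :: "'e::finite set set \<Rightarrow> 'e set \<Rightarrow> nat" where
  "rk I X = Max (card ` {Y \<in> I. Y \<subseteq> X})"

definition cl :: "'e::finite set set \<Rightarrow> 'e set \<Rightarrow> 'e set" where
  "cl I X = {e. rk I (insert e X) = rk I X}"

definition flat :: "'e::finite set set \<Rightarrow> 'e set \<Rightarrow> bool" where
  "flat I F \<longleftrightarrow> cl I F = F"

definition basis :: "'e::finite set set \<Rightarrow> 'e set \<Rightarrow> bool" where
  "basis I B \<longleftrightarrow> B \<in> I \<and> (\<forall>X\<in>I. B \<subseteq> X \<longrightarrow> X = B)"

definition circuit :: "'e::finite set set \<Rightarrow> 'e set \<Rightarrow> bool" where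
  "circuit I C \<longleftrightarrow> C \<notin> I \<and> (\<forall>X. X \<subset> C \<longrightarrow> X \<in> I)"

text \<open>Only meaningful for a basis \<open>B\<close> and \<open>e \<notin> B\<close>.\<close>

definition fundamental_circuit :: "'e::finite set set \<Rightarrow> 'e set \<Rightarrow> 'e \<Rightarrow> 'e set" where
  "fundamental_circuit I B e = (THE C. circuit I C \<and> C \<subseteq> insert e B)"

text \<open>The index set \<open>[r]\<close> is a finite type \<open>'r\<close> with \<open>r\<close> elements.\<close>

definition ordered_basis :: "'e::finite set set \<Rightarrow> ('r::finite \<Rightarrow> 'e) \<Rightarrow> bool" where
  "ordered_basis I b \<longleftrightarrow> inj b \<and> basis I (range b)"


section \<open>Flags, the permutohedral fan and the Bergman fan\<close>

text \<open>
  A flag \<open>{} = W\<^sup>0 \<subset> W\<^sup>1 \<subset> \<dots> \<subset> W\<^sup>k = UNIV\<close> is the list of its members including the empty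
  set, so that \<open>W ! i\<close> is \<open>W\<^sup>i\<close>.
\<close>

definition is_flag :: "'i::finite set list \<Rightarrow> bool" where
  "is_flag W \<longleftrightarrow> W \<noteq> [] \<and> hd W = {} \<and> last W = UNIV \<and> sorted_wrt (\<subset>) W"

definition full_flag :: "'i::finite set list \<Rightarrow> bool" where
  "full_flag W \<longleftrightarrow> is_flag W \<and> length W = Suc CARD('i)"

definition ind_vec :: "'i::finite set \<Rightarrow> real ^ 'i" where
  "ind_vec S = (\<chi> i. indicator S i)"

definition flag_cone :: "'i::finite set list \<Rightarrow> (real ^ 'i) set" where
  "flag_cone W =
     {x + y | x y. x \<in> convex_cone hull {ind_vec (W ! i) | i. 1 \<le> i \<and> i < length W - 1} \<and>
                   y \<in> span {ind_vec UNIV}}"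

text \<open>
  Cones in a quotient by the line spanned by the all-ones vector are represented by their
  preimages, which contain this line.
\<close>

definition permutohedral_fan :: "(real ^ 'r::finite) set set" where
  "permutohedral_fan = {flag_cone W | W. is_flag W}"

definition bergman_fan :: "'e::finite set set \<Rightarrow> (real ^ 'e) set set" where
  "bergman_fan I = {flag_cone F | F. is_flag F \<and> (\<forall>S\<in>set F. flat I S)}"

text \<open>
  Edges of the permutohedron, whose vertices are the full flags: two full flags span
  an edge iff they differ in exactly one member.
\<close>

definition permutohedron_edge :: "'r::finite set list \<Rightarrow> 'r set list \<Rightarrow> bool" where
  "permutohedron_edge W W' \<longleftrightarrow> full_flag W \<and> full_flag W' \<and>
     card {i. i \<le> CARD('r) \<and> W ! i \<noteq> W' ! i} = 1"


section \<open>Tropical bundles\<close>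

text \<open>The map \<open>\<phi>\<^sub>B\<close>, with \<open>\<real>\<^sup>B\<close> identified with \<open>\<real>\<^sup>r\<close> by the ordering \<open>b\<close> of \<open>B\<close>.\<close>

definition phi :: "'e::finite set set \<Rightarrow> ('r::finite \<Rightarrow> 'e) \<Rightarrow> real ^ 'r \<Rightarrow> real ^ 'e" where
  "phi I b w = (\<chi> e. if e \<in> range b then w $ inv b e
     else Min {w $ j | j. b j \<in> fundamental_circuit I (range b) e - {e}})"

definition proj_basis :: "('r::finite \<Rightarrow> 'e::finite) \<Rightarrow> real ^ 'e \<Rightarrow> real ^ 'r" where
  "proj_basis b y = (\<chi> j. y $ b j)"

text \<open>
  A linear map on \<open>span \<delta>\<close> is represented by any linear extension to the ambient space;
  integrality is only required on \<open>N \<inter> span \<delta>\<close>.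
\<close>

definition integral_linear_on ::
    "'a::euclidean_space set \<Rightarrow> 'a set \<Rightarrow> ('a \<Rightarrow> real ^ 'r::finite) \<Rightarrow> bool" where
  "integral_linear_on N V T \<longleftrightarrow> linear T \<and> (\<forall>x\<in>N \<inter> V. \<forall>j. T x $ j \<in> \<int>)"

definition local_form :: "'a::euclidean_space set \<Rightarrow> 'e::finite set set \<Rightarrow> ('a \<Rightarrow> real ^ 'e) \<Rightarrow>
    'a set \<Rightarrow> ('r::finite \<Rightarrow> 'e) \<Rightarrow> ('a \<Rightarrow> real ^ 'r) \<Rightarrow> bool" where
  "local_form N I \<Phi> \<delta> b T \<longleftrightarrow> ordered_basis I b \<and> integral_linear_on N (span \<delta>) T \<and>
     (\<forall>x\<in>\<delta>. \<Phi> x = phi I b (T x))"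

text \<open>The rank of the bundle is passed as a type of cardinality \<open>r\<close>.\<close>

definition tropical_bundle :: "'r::finite itself \<Rightarrow> 'a::euclidean_space set \<Rightarrow> 'a set set \<Rightarrow>
    'e::finite set set \<Rightarrow> ('a \<Rightarrow> real ^ 'e) \<Rightarrow> bool" where
  "tropical_bundle r N \<Delta> I \<Phi> \<longleftrightarrow>
     \<Phi> ` \<Union>\<Delta> \<subseteq> \<Union>(bergman_fan I) \<and>
     (\<forall>\<delta>\<in>\<Delta>. \<exists>(b :: 'r \<Rightarrow> 'e) T. local_form N I \<Phi> \<delta> b T)"

definition char_map :: "('r::finite \<Rightarrow> 'a::euclidean_space) \<Rightarrow> 'a \<Rightarrow> real ^ 'r" where
  "char_map u x = (\<chi> j. u j \<bullet> x)"

definition trivial_bundle :: "'r::finite itself \<Rightarrow> 'a::euclidean_space set \<Rightarrow> 'a set set \<Rightarrow>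
    'e::finite set set \<Rightarrow> ('a \<Rightarrow> real ^ 'e) \<Rightarrow> bool" where
  "trivial_bundle r N \<Delta> I \<Phi> \<longleftrightarrow>
     (\<exists>(b :: 'r \<Rightarrow> 'e) v. ordered_basis I b \<and> (\<forall>j. v j \<in> dual_lattice N) \<and>
        (\<forall>x\<in>\<Union>\<Delta>. \<Phi> x = phi I b (char_map v x)))"

definition elem_sym :: "nat \<Rightarrow> real ^ 'r::finite \<Rightarrow> real" where
  "elem_sym i w = (\<Sum>S | card S = i. \<Prod>j\<in>S. w $ j)"

text \<open>
  The value at \<open>x\<close> does not depend on the chosen cone and basis: the multiset of coordinates
  of \<open>\<Phi> x\<close> at the elements of an admissible basis is determined by the superlevel flats
  of \<open>\<Phi> x\<close>.
\<close>

definition chern_class :: "'r::finite itself \<Rightarrow> 'a::euclidean_space set \<Rightarrow> 'a set set \<Rightarrow>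
    'e::finite set set \<Rightarrow> ('a \<Rightarrow> real ^ 'e) \<Rightarrow> nat \<Rightarrow> 'a \<Rightarrow> real" where
  "chern_class r N \<Delta> I \<Phi> i x =
     (SOME c. \<exists>\<delta>\<in>\<Delta>. \<exists>(b :: 'r \<Rightarrow> 'e) T. x \<in> \<delta> \<and> local_form N I \<Phi> \<delta> b T \<and>
        c = elem_sym i (proj_basis b (\<Phi> x)))"

definition trivial_chern_class :: "'r::finite itself \<Rightarrow> 'a::euclidean_space set \<Rightarrow> 'a set set \<Rightarrow>
    'e::finite set set \<Rightarrow> ('a \<Rightarrow> real ^ 'e) \<Rightarrow> bool" where
  "trivial_chern_class r N \<Delta> I \<Phi> \<longleftrightarrow>
     (\<exists>p. real_polynomial_function p \<and>
        (\<forall>x\<in>\<Union>\<Delta>. 1 + (\<Sum>i=1..CARD('r). chern_class r N \<Delta> I \<Phi> i x) = p x))"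

definition chern_roots :: "'a::euclidean_space set \<Rightarrow> 'a set set \<Rightarrow> 'e::finite set set \<Rightarrow>
    ('a \<Rightarrow> real ^ 'e) \<Rightarrow> ('r::finite \<Rightarrow> 'a) \<Rightarrow> bool" where
  "chern_roots N \<Delta> I \<Phi> u \<longleftrightarrow> (\<forall>j. u j \<in> dual_lattice N) \<and>
     (\<forall>\<delta>\<in>\<Delta>. \<exists>b. local_form N I \<Phi> \<delta> b (char_map u))"

text \<open>Affine independence of a family, so repeated members are excluded.\<close>

definition affinely_independent :: "('r::finite \<Rightarrow> 'a::euclidean_space) \<Rightarrow> bool" where
  "affinely_independent u \<longleftrightarrow> inj u \<and> \<not> affine_dependent (range u)"


section \<open>The coarsening of the permutohedral fan\<close>

definition flag_at :: "('r::finite \<Rightarrow> 'a::euclidean_space) \<Rightarrow> 'a \<Rightarrow> 'r set list" where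
  "flag_at u x =
     {} # map (\<lambda>l. {j. u j \<bullet> x \<ge> l}) (rev (sorted_list_of_set (range (\<lambda>j. u j \<bullet> x))))"

definition basis_flag :: "'e::finite set set \<Rightarrow> ('r::finite \<Rightarrow> 'e) \<Rightarrow> 'r set list \<Rightarrow> 'e set list" where
  "basis_flag I b W = map (\<lambda>S. cl I (b ` S)) W"

definition flat_flag :: "'a::euclidean_space set \<Rightarrow> 'a set set \<Rightarrow> 'e::finite set set \<Rightarrow>
    ('a \<Rightarrow> real ^ 'e) \<Rightarrow> ('r::finite \<Rightarrow> 'a) \<Rightarrow> 'r set list \<Rightarrow> 'e set list" where
  "flat_flag N \<Delta> I \<Phi> u W =
     (SOME F. \<exists>x. \<exists>\<delta>\<in>\<Delta>. \<exists>b. x \<in> \<delta> \<and> W = flag_at u x \<and>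
        local_form N I \<Phi> \<delta> b (char_map u) \<and> F = basis_flag I b W)"

definition compatible_edges :: "'e::finite set set \<Rightarrow> ('r::finite set list \<Rightarrow> 'e set list) \<Rightarrow>
    ('r set list \<times> 'r set list) set" where
  "compatible_edges I F =
     {(W, W'). permutohedron_edge W W' \<and>
        (\<exists>b. ordered_basis I b \<and> F W = basis_flag I b W \<and> F W' = basis_flag I b W')}"

definition Xi_maximal_cones :: "'a::euclidean_space set \<Rightarrow> 'a set set \<Rightarrow> 'e::finite set set \<Rightarrow>
    ('a \<Rightarrow> real ^ 'e) \<Rightarrow> ('r::finite \<Rightarrow> 'a) \<Rightarrow> (real ^ 'r) set set" where
  "Xi_maximal_cones N \<Delta> I \<Phi> u =
     {\<Union> (flag_cone ` {W'. (W, W') \<in> (compatible_edges I (flat_flag N \<Delta> I \<Phi> u))\<^sup>*}) | W.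
        full_flag W}"

text \<open>
  A fan consists of its maximal cones and their nonempty faces. The maximal cones are listed
  separately because a set is a face of itself in the sense of \<open>face_of\<close> only if it is convex;
  this holds for the unions above, but is a theorem.
\<close>

definition Xi :: "'a::euclidean_space set \<Rightarrow> 'a set set \<Rightarrow> 'e::finite set set \<Rightarrow>
    ('a \<Rightarrow> real ^ 'e) \<Rightarrow> ('r::finite \<Rightarrow> 'a) \<Rightarrow> (real ^ 'r) set set" where
  "Xi N \<Delta> I \<Phi> u = Xi_maximal_cones N \<Delta> I \<Phi> u \<union>
     {\<tau>. \<tau> \<noteq> {} \<and> (\<exists>C\<in>Xi_maximal_cones N \<Delta> I \<Phi> u. \<tau> face_of C)}"

end

theory Submission
  imports Defs
begin

text \<open>
  The superlevel sets of \<open>\<phi>\<^sub>B w\<close> are the closures of those of \<open>w\<close>. Hence for \<open>S \<subseteq> [r]\<close> the flat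
  \<open>G S = cl (b ` S)\<close>, for a point of a cone \<open>\<delta>\<close> where the roots in \<open>S\<close> exceed the others and \<open>b = B\<^sub>\<delta>\<close>,
  is locally constant on a convex set of points, so it depends on \<open>S\<close> only, and \<open>F(W)\<^sup>i = G (W\<^sup>i)\<close>.
  The bundle is trivial iff \<open>G S = cl (b ` S)\<close> for a single basis \<open>b\<close> and all \<open>S\<close>.

  Given such a \<open>b\<close>, all edges are compatible, and the permutohedron is connected. Conversely,
  let all full flags be connected by compatible edges. Across an edge exchanging \<open>j\<close> and \<open>k\<close> over
  \<open>A\<close>, compatibility means that \<open>G (A \<union> {j}) \<noteq> G (A \<union> {k})\<close>; if it holds on three consecutive edges of
  a hexagon it holds on the other three. As in the solution of the word problem for Coxeter
  groups, compatible galleries can therefore be shortened to compatible geodesics. In particular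
  every single edge is compatible, and then generators of the flats \<open>G {j}\<close> form the desired basis.
\<close>

section \<open>Rank and closure\<close>

context
  fixes I :: "'e::finite set set"
  assumes mat: "is_matroid I"
begin

lemma indep_subset: "X \<in> I \<Longrightarrow> Y \<subseteq> X \<Longrightarrow> Y \<in> I"
  using mat unfolding is_matroid_def by blast

lemma indep_augment:
  assumes "X \<in> I" "Y \<in> I"
  obtains Z where "Z \<in> I" "X \<subseteq> Z" "Z \<subseteq> X \<union> Y" "card Y \<le> card Z"
proof -
  let ?S = "{Z \<in> I. X \<subseteq> Z \<and> Z \<subseteq> X \<union> Y}"
  have "X \<in> ?S" using assms by auto
  then have "Max (card ` ?S) \<in> card ` ?S" by (intro Max_in) auto
  then obtain Z where Z: "Z \<in> ?S" and "card Z = Max (card ` ?S)" by (metis (no_types, lifting) imageE)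
  then have max: "card Z' \<le> card Z" if "Z' \<in> ?S" for Z' using that by simp
  have "card Y \<le> card Z"
  proof (rule ccontr)
    assume "\<not> card Y \<le> card Z"
    then obtain e where e: "e \<in> Y - Z" "insert e Z \<in> I"
      using mat Z assms unfolding is_matroid_def by (metis (no_types, lifting) mem_Collect_eq not_le)
    then have "insert e Z \<in> ?S" using Z by auto
    from max[OF this] e show False by simp
  qed
  then show thesis using that Z by blast
qed

lemma card_le_rk: "Y \<in> I \<Longrightarrow> Y \<subseteq> X \<Longrightarrow> card Y \<le> rk I X"
  unfolding rk_def by (rule Max_ge) auto

lemma rk_witness:
  obtains Y where "Y \<in> I" "Y \<subseteq> X" "card Y = rk I X"
proof -
  have "{} \<in> I" using mat unfolding is_matroid_def by blast
  then have "card ` {Y \<in> I. Y \<subseteq> X} \<noteq> {}" by auto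
  from Max_in[OF _ this] have "rk I X \<in> card ` {Y \<in> I. Y \<subseteq> X}" unfolding rk_def by simp
  then show thesis using that by auto
qed

lemma rk_mono: "X \<subseteq> Y \<Longrightarrow> rk I X \<le> rk I Y"
  by (metis card_le_rk rk_witness subset_trans)

lemma rk_le_card: "rk I X \<le> card X"
  by (metis card_mono finite rk_witness)

lemma rk_indep: "X \<in> I \<Longrightarrow> rk I X = card X"
  by (simp add: card_le_rk le_antisym rk_le_card)

lemma indep_if_rk_eq_card: "rk I X = card X \<Longrightarrow> X \<in> I"
  by (metis card_subset_eq finite rk_witness)

lemma cl_superset: "X \<subseteq> cl I X"
  unfolding cl_def by (auto simp: insert_absorb)

lemma rk_cl: "rk I (cl I X) = rk I X"
proof (rule antisym)
  obtain Y where Y: "Y \<in> I" "Y \<subseteq> X" "card Y = rk I X" by (rule rk_witness)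
  obtain Z where Z: "Z \<in> I" "Z \<subseteq> cl I X" "card Z = rk I (cl I X)" by (rule rk_witness)
  show "rk I (cl I X) \<le> rk I X"
  proof (rule ccontr)
    assume "\<not> ?thesis"
    then have "card Y < card Z" using Y Z by simp
    then obtain e where e: "e \<in> Z - Y" "insert e Y \<in> I"
      using mat Y(1) Z(1) unfolding is_matroid_def by blast
    then have "Suc (card Y) \<le> rk I (insert e X)"
      using card_le_rk[of "insert e Y" "insert e X"] Y(2) by auto
    moreover have "e \<in> cl I X" using e Z by auto
    ultimately show False using Y(3) unfolding cl_def by auto
  qed
qed (rule rk_mono[OF cl_superset])

lemma cl_mono:
  assumes "X \<subseteq> Y" shows "cl I X \<subseteq> cl I Y"
proof
  fix e assume e: "e \<in> cl I X"
  obtain A where A: "A \<in> I" "A \<subseteq> X" "card A = rk I X" by (rule rk_witness)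
  obtain B0 where B0: "B0 \<in> I" "B0 \<subseteq> Y" "card B0 = rk I Y" by (rule rk_witness)
  obtain B where B: "B \<in> I" "A \<subseteq> B" "B \<subseteq> A \<union> B0" "card B0 \<le> card B"
    by (rule indep_augment[OF A(1) B0(1)])
  have BY: "B \<subseteq> Y" using A B B0 assms by blast
  have cB: "card B = rk I Y" using B B0 card_le_rk[OF B(1) BY] by simp
  obtain Z where Z: "Z \<in> I" "Z \<subseteq> insert e Y" "card Z = rk I (insert e Y)" by (rule rk_witness)
  show "e \<in> cl I Y"
  proof (rule ccontr)
    assume "e \<notin> cl I Y"
    then have "rk I Y < rk I (insert e Y)"
      using rk_mono[OF subset_insertI[of Y e]] unfolding cl_def by simp
    then obtain f where f: "f \<in> Z - B" "insert f B \<in> I"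
      using mat B(1) Z cB unfolding is_matroid_def by metis
    have "f \<notin> Y"
      using card_le_rk[OF f(2), of Y] f(1) BY cB by auto
    then have "f = e" using f Z by auto
    then have "insert e A \<in> I" "e \<notin> A"
      using indep_subset[OF f(2), of "insert e A"] f B by auto
    then have "Suc (rk I X) \<le> rk I (insert e X)"
      using card_le_rk[of "insert e A" "insert e X"] A by auto
    then show False using e unfolding cl_def by auto
  qed
qed

lemma cl_idem: "cl I (cl I X) = cl I X"
proof
  show "cl I (cl I X) \<subseteq> cl I X"
  proof
    fix e assume "e \<in> cl I (cl I X)"
    then have "rk I (insert e (cl I X)) = rk I X" unfolding cl_def[of I "cl I X"] by (simp add: rk_cl)
    moreover have "rk I (insert e X) \<le> rk I (insert e (cl I X))"
      by (rule rk_mono) (use cl_superset in blast)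
    moreover have "rk I X \<le> rk I (insert e X)" by (rule rk_mono) blast
    ultimately show "e \<in> cl I X" unfolding cl_def by simp
  qed
qed (rule cl_superset)

lemma flat_cl: "flat I (cl I X)"
  by (simp add: flat_def cl_idem)

lemma cl_subset_flat: "flat I F \<Longrightarrow> X \<subseteq> F \<Longrightarrow> cl I X \<subseteq> F"
  by (metis cl_mono flat_def)

lemma cl_eq_flat:
  assumes "flat I F" "X \<subseteq> F" "rk I F \<le> rk I X"
  shows "cl I X = F"
proof
  show "F \<subseteq> cl I X"
  proof
    fix e assume "e \<in> F"
    then have "rk I (insert e X) \<le> rk I F" using assms by (intro rk_mono) auto
    moreover have "rk I X \<le> rk I (insert e X)" by (rule rk_mono) blast
    ultimately show "e \<in> cl I X" using assms unfolding cl_def by simp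
  qed
qed (rule cl_subset_flat[OF assms(1,2)])

lemma flat_eq:
  assumes "flat I F" "flat I F'" "F \<subseteq> F'" "rk I F' \<le> rk I F"
  shows "F = F'"
  using cl_eq_flat[OF assms(2,3,4)] assms(1) by (simp add: flat_def)

lemma rk_union_flats:
  assumes "flat I F" "flat I F'" "rk I F = k" "rk I F' = k" "F \<noteq> F'"
  shows "Suc k \<le> rk I (F \<union> F')"
proof -
  have "\<not> F' \<subseteq> F" using flat_eq[of F' F] assms by auto
  then obtain e where e: "e \<in> F'" "e \<notin> F" by blast
  have "rk I F < rk I (insert e F)"
    using e assms(1) rk_mono[of F "insert e F"] unfolding flat_def cl_def
    by (metis (mono_tags, lifting) le_neq_implies_less mem_Collect_eq subset_insertI)
  also have "\<dots> \<le> rk I (F \<union> F')" using e by (intro rk_mono) auto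
  finally show ?thesis using assms by simp
qed

lemma flat_join_unique:
  assumes "flat I F" "flat I F'" "rk I F = k" "rk I F' = k" "F \<noteq> F'"
    and "flat I X" "rk I X = Suc k" "F \<union> F' \<subseteq> X"
    and "flat I Y" "rk I Y = Suc k" "F \<union> F' \<subseteq> Y"
  shows "X = Y"
  using cl_eq_flat[of X "F \<union> F'"] cl_eq_flat[of Y "F \<union> F'"] rk_union_flats[OF assms(1-5)] assms
  by simp

section \<open>Fundamental circuits and superlevel sets\<close>

lemma indep_card_basis:
  assumes "B \<in> I" "card B = rk I UNIV" shows "basis I B"
  unfolding basis_def
proof (intro conjI ballI impI)
  fix X assume "X \<in> I" "B \<subseteq> X"
  then show "X = B" using card_le_rk[of X UNIV] card_seteq[of X B] assms by simp
qed (fact assms)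

lemma dependent_contains_circuit:
  assumes "X \<notin> I" obtains C where "circuit I C" "C \<subseteq> X"
proof -
  obtain C where C: "C \<notin> I" "C \<subseteq> X" "\<And>D. D \<subseteq> X \<Longrightarrow> D \<notin> I \<Longrightarrow> D \<subseteq> C \<Longrightarrow> C = D"
    using finite_has_minimal2[of "{D. D \<subseteq> X \<and> D \<notin> I}" X] assms by auto
  have "circuit I C" unfolding circuit_def using C by blast
  then show thesis using that C by blast
qed

lemma circuit_insert_basis:
  assumes B: "basis I B" and e: "e \<notin> B" and D: "circuit I D" "D \<subseteq> insert e B"
  shows "D = insert e {f \<in> B. insert e (B - {f}) \<in> I}"
proof -
  have BI: "B \<in> I" using B by (simp add: basis_def)
  have DI: "D \<notin> I" using D by (simp add: circuit_def)
  have eD: "e \<in> D" using D(2) DI indep_subset[OF BI] by blast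
  have "insert e (B - {f}) \<in> I" if f: "f \<in> D" "f \<noteq> e" for f
  proof -
    have fB: "f \<in> B" using f D by auto
    have "D - {f} \<in> I" using D(1) f unfolding circuit_def by blast
    then obtain Z where Z: "Z \<in> I" "D - {f} \<subseteq> Z" "Z \<subseteq> (D - {f}) \<union> B" "card B \<le> card Z"
      using indep_augment[OF _ BI] by metis
    have "f \<notin> Z" using Z DI indep_subset[of Z D] by blast
    then have "Z \<subseteq> insert e (B - {f})" using Z D by blast
    moreover have "card (insert e (B - {f})) = Suc (card (B - {f}))"
      using e by (intro card_insert_disjoint) auto
    then have "card (insert e (B - {f})) = card B"
      using card_Suc_Diff1[OF finite fB] by metis
    ultimately have "Z = insert e (B - {f})" using Z(4) by (intro card_seteq) auto
    then show ?thesis using Z by simp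
  qed
  moreover have "f \<in> D" if "f \<in> B" "insert e (B - {f}) \<in> I" for f
  proof (rule ccontr)
    assume "f \<notin> D"
    then have "D \<subseteq> insert e (B - {f})" using D by auto
    then show False using indep_subset[OF that(2)] DI by blast
  qed
  ultimately show ?thesis using eD D(2) by auto
qed

lemma fundamental_circuit:
  assumes B: "basis I B" and e: "e \<notin> B"
  shows "circuit I (fundamental_circuit I B e)"
    and "fundamental_circuit I B e \<subseteq> insert e B"
    and "circuit I D \<Longrightarrow> D \<subseteq> insert e B \<Longrightarrow> D = fundamental_circuit I B e"
proof -
  have uniq: "D = D'" if "circuit I D" "D \<subseteq> insert e B" "circuit I D'" "D' \<subseteq> insert e B" for D D'
    by (rule trans[OF circuit_insert_basis[OF assms that(1,2)] circuit_insert_basis[OF assms that(3,4), symmetric]])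
  have "insert e B \<notin> I" using B e unfolding basis_def by blast
  then obtain C where C: "circuit I C" "C \<subseteq> insert e B" by (rule dependent_contains_circuit)
  have "\<exists>!C. circuit I C \<and> C \<subseteq> insert e B"
    by (rule ex1I[of _ C]) (use C uniq in blast)+
  from theI'[OF this] have *: "circuit I (fundamental_circuit I B e) \<and> fundamental_circuit I B e \<subseteq> insert e B"
    unfolding fundamental_circuit_def .
  then show "circuit I (fundamental_circuit I B e)" "fundamental_circuit I B e \<subseteq> insert e B" by auto
  show "circuit I D \<Longrightarrow> D \<subseteq> insert e B \<Longrightarrow> D = fundamental_circuit I B e"
    using * uniq by blast
qed

lemma mem_cl_indep_iff:
  assumes "X \<in> I" shows "e \<in> cl I X \<longleftrightarrow> e \<in> X \<or> insert e X \<notin> I"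
proof (cases "e \<in> X")
  case False
  have "rk I X \<le> rk I (insert e X)" by (rule rk_mono) blast
  moreover have "rk I (insert e X) \<le> Suc (card X)" using rk_le_card[of "insert e X"] False by simp
  moreover have "insert e X \<in> I \<longleftrightarrow> rk I (insert e X) = Suc (card X)"
    using rk_indep[of "insert e X"] indep_if_rk_eq_card[of "insert e X"] False by auto
  moreover have "rk I X = card X" using assms by (rule rk_indep)
  ultimately have "rk I (insert e X) = rk I X \<longleftrightarrow> insert e X \<notin> I" by linarith
  then show ?thesis using False unfolding cl_def by simp
qed (use cl_superset in auto)

lemma mem_cl_subset_basis_iff:
  assumes B: "basis I B" and e: "e \<notin> B" and X: "X \<subseteq> B"
  shows "e \<in> cl I X \<longleftrightarrow> fundamental_circuit I B e - {e} \<subseteq> X"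
proof -
  let ?C = "fundamental_circuit I B e"
  note C = fundamental_circuit[OF B e]
  have XI: "X \<in> I" using B X indep_subset unfolding basis_def by blast
  have "e \<in> cl I X \<longleftrightarrow> insert e X \<notin> I" using mem_cl_indep_iff[OF XI] e X by blast
  also have "\<dots> \<longleftrightarrow> ?C \<subseteq> insert e X"
  proof
    assume "insert e X \<notin> I"
    then obtain D where "circuit I D" "D \<subseteq> insert e X" by (rule dependent_contains_circuit)
    then show "?C \<subseteq> insert e X" using C(3)[of D] X by blast
  next
    assume "?C \<subseteq> insert e X"
    then show "insert e X \<notin> I" using C(1) indep_subset unfolding circuit_def by blast
  qed
  also have "\<dots> \<longleftrightarrow> ?C - {e} \<subseteq> X" by blast
  finally show ?thesis .
qed

lemma superlevel_phi:
  fixes b :: "'r::finite \<Rightarrow> 'e"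
  assumes ll: "loopless I" and b: "ordered_basis I b"
  shows "{e. l \<le> phi I b w $ e} = cl I (b ` {j. l \<le> w $ j})"
proof -
  let ?X = "b ` {j. l \<le> w $ j}"
  have inj: "inj b" and B: "basis I (range b)" using b by (auto simp: ordered_basis_def)
  have XI: "?X \<in> I" using B indep_subset[of "range b" ?X] unfolding basis_def by auto
  have "l \<le> phi I b w $ e \<longleftrightarrow> e \<in> cl I ?X" for e
  proof (cases "e \<in> range b")
    case True
    then obtain j where j: "e = b j" by blast
    have "insert e ?X \<in> I" using B indep_subset[of "range b" "insert e ?X"] j unfolding basis_def by auto
    then have "e \<in> cl I ?X \<longleftrightarrow> e \<in> ?X" using mem_cl_indep_iff[OF XI] by blast
    then show ?thesis using j inj by (auto simp: phi_def inj_def)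
  next
    case False
    let ?C = "fundamental_circuit I (range b) e"
    let ?V = "{w $ j | j. b j \<in> ?C - {e}}"
    note C = fundamental_circuit[OF B False]
    have "?C \<noteq> {e}" "?C \<noteq> {}" using C(1) ll mat unfolding circuit_def loopless_def is_matroid_def by auto
    then have ne: "?V \<noteq> {}" using C(2) by blast
    have fin: "finite ?V" using finite_subset[of ?V "range (($) w)"] by auto
    have "l \<le> phi I b w $ e \<longleftrightarrow> l \<le> Min ?V" using False by (simp add: phi_def)
    also have "\<dots> \<longleftrightarrow> (\<forall>j. b j \<in> ?C - {e} \<longrightarrow> l \<le> w $ j)"
      using Min_ge_iff[OF fin ne] by blast
    also have "\<dots> \<longleftrightarrow> ?C - {e} \<subseteq> ?X"
      using C(2) inj by (fastforce simp: inj_def)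
    also have "\<dots> \<longleftrightarrow> e \<in> cl I ?X"
      using mem_cl_subset_basis_iff[OF B False, of ?X] by blast
    finally show ?thesis .
  qed
  then show ?thesis by blast
qed

lemma rk_ordered_basis_image:
  assumes "ordered_basis I b" shows "rk I (b ` S) = card S"
proof -
  have "b ` S \<in> I" using assms indep_subset[of "range b" "b ` S"]
    unfolding ordered_basis_def basis_def by auto
  then show ?thesis using rk_indep assms unfolding ordered_basis_def
    by (metis card_image inj_on_subset subset_UNIV)
qed

end

section \<open>Adjacent transpositions\<close>

definition adjacent_swap :: "'r list \<Rightarrow> 'r list \<Rightarrow> bool" where
  "adjacent_swap xs ys \<longleftrightarrow> (\<exists>p a b s. xs = p @ a # b # s \<and> ys = p @ b # a # s)"

lemma adjacent_swapI: "adjacent_swap (p @ a # b # s) (p @ b # a # s)"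
  unfolding adjacent_swap_def by blast

lemma adjacent_swap_Cons:
  "adjacent_swap\<^sup>*\<^sup>* xs ys \<Longrightarrow> adjacent_swap\<^sup>*\<^sup>* (x # xs) (x # ys)"
proof (induction rule: rtranclp_induct)
  case (step ys zs)
  then obtain p a b s where "ys = p @ a # b # s" "zs = p @ b # a # s"
    unfolding adjacent_swap_def by blast
  then have "adjacent_swap (x # ys) (x # zs)" using adjacent_swapI[of "x # p" a b s] by simp
  with step.IH show ?case by (rule rtranclp.rtrancl_into_rtrancl)
qed simp

lemma adjacent_swap_to_front: "adjacent_swap\<^sup>*\<^sup>* (p @ a # s) (a # p @ s)"
proof (induction p)
  case (Cons x p)
  have "adjacent_swap\<^sup>*\<^sup>* ((x # p) @ a # s) (x # a # p @ s)" using adjacent_swap_Cons[OF Cons, of x] by simp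
  moreover have "adjacent_swap (x # a # p @ s) (a # x # p @ s)" using adjacent_swapI[of "[]" x a "p @ s"] by simp
  ultimately have "adjacent_swap\<^sup>*\<^sup>* ((x # p) @ a # s) (a # x # p @ s)" by (rule rtranclp.rtrancl_into_rtrancl)
  then show ?case by simp
qed simp

lemma adjacent_swap_connected:
  assumes "distinct xs" "distinct ys" "set xs = set ys"
  shows "adjacent_swap\<^sup>*\<^sup>* xs ys"
  using assms
proof (induction ys arbitrary: xs)
  case (Cons y ys)
  then obtain p s where xs: "xs = p @ y # s" by (metis list.set_intros(1) split_list)
  have "set (p @ s) = set ys" "distinct (p @ s)" using Cons.prems xs by auto
  then have "adjacent_swap\<^sup>*\<^sup>* (p @ s) ys" using Cons by simp
  then have "adjacent_swap\<^sup>*\<^sup>* (y # p @ s) (y # ys)" by (rule adjacent_swap_Cons)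
  then show ?case unfolding xs by (rule rtranclp_trans[OF adjacent_swap_to_front])
qed simp

lemma adjacent_swap_unique:
  assumes "p @ a # b # s = p' @ a' # b' # s'" "p @ b # a # s = p' @ b' # a' # s'" "a \<noteq> b" "a' \<noteq> b'"
  shows "p = p'" "a = a'" "b = b'" "s = s'"
proof -
  from assms(1) consider (1) us where "p = p' @ us" "us @ a # b # s = a' # b' # s'"
    | (2) us where "p' = p @ us" "us @ a' # b' # s' = a # b # s"
    unfolding append_eq_append_conv2 by metis
  then have "p = p'"
  proof cases
    case 1 then show ?thesis using assms(2,4) by (cases us) auto
  next
    case 2 then show ?thesis using assms(2,3) by (cases us) auto
  qed
  then show "p = p'" "a = a'" "b = b'" "s = s'" using assms(1) by auto
qed

section \<open>Systems of flats indexed by subsets\<close>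

definition compatible_swap :: "('r set \<Rightarrow> 'e set) \<Rightarrow> 'r list \<Rightarrow> 'r list \<Rightarrow> bool" where
  "compatible_swap G xs ys \<longleftrightarrow> (\<exists>p a b s. xs = p @ a # b # s \<and> ys = p @ b # a # s \<and>
     G (insert a (set p)) \<noteq> G (insert b (set p)))"

definition compatible_ascent ::
    "('r set \<Rightarrow> 'e set) \<Rightarrow> ('r \<Rightarrow> nat) \<Rightarrow> 'r list \<Rightarrow> 'r list \<Rightarrow> bool" where
  "compatible_ascent G \<rho> xs ys \<longleftrightarrow> (\<exists>p a b s. xs = p @ a # b # s \<and> ys = p @ b # a # s \<and>
     \<rho> a < \<rho> b \<and> G (insert a (set p)) \<noteq> G (insert b (set p)))"

lemma compatible_ascent_iff:
  "compatible_ascent G \<rho> (p @ a # b # s) (p @ b # a # s) \<longleftrightarrow>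
     \<rho> a < \<rho> b \<and> G (insert a (set p)) \<noteq> G (insert b (set p))"
proof
  assume "compatible_ascent G \<rho> (p @ a # b # s) (p @ b # a # s)"
  then obtain p' a' b' s' where *: "p @ a # b # s = p' @ a' # b' # s'" "p @ b # a # s = p' @ b' # a' # s'"
    "\<rho> a' < \<rho> b'" "G (insert a' (set p')) \<noteq> G (insert b' (set p'))"
    unfolding compatible_ascent_def by metis
  have "a \<noteq> b"
  proof
    assume "a = b"
    then have "p @ a # b # s = p @ b # a # s" by simp
    from trans[OF trans[OF *(1)[symmetric] this] *(2)] have "a' = b'"
      by (metis nth_append_length)
    then show False using *(3) by simp
  qed
  from adjacent_swap_unique[OF *(1,2) this] *(3,4)
  show "\<rho> a < \<rho> b \<and> G (insert a (set p)) \<noteq> G (insert b (set p))" by auto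
qed (auto simp: compatible_ascent_def)

lemma descents_cases:
  assumes "p @ b # a # s = q @ d # c # t"
  obtains "p = q" "a = c" "b = d" "s = t"
  | "q = p @ [b]" "d = a" "s = c # t"
  | "p = q @ [d]" "b = c" "t = a # s"
  | m where "q = p @ b # a # m" "s = m @ d # c # t"
  | m where "p = q @ d # c # m" "t = m @ b # a # s"
proof -
  from assms consider (1) us where "p = q @ us" "us @ b # a # s = d # c # t"
    | (2) us where "q = p @ us" "us @ d # c # t = b # a # s"
    unfolding append_eq_append_conv2 by metis
  then show thesis
  proof cases
    case 1
    show thesis
    proof (cases us)
      case Nil then show thesis using 1 that(1) by simp
    next
      case (Cons x us')
      then show thesis using 1 that(3,5) by (cases us') auto
    qed
  next
    case 2
    show thesis
    proof (cases us)
      case Nil then show thesis using 2 that(1) by simp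
    next
      case (Cons x us')
      then show thesis using 2 that(2,4) by (cases us') auto
    qed
  qed
qed

context
  fixes I :: "'e::finite set set" and G :: "'r::finite set \<Rightarrow> 'e set"
  assumes mat: "is_matroid I"
    and flat_G: "\<And>S. flat I (G S)"
    and rk_G: "\<And>S. rk I (G S) = card S"
    and mono_G: "\<And>S T. S \<subseteq> T \<Longrightarrow> G S \<subseteq> G T"
begin

lemma join_unique:
  assumes "G S \<noteq> G T" "card S = k" "card T = k" "card X = Suc k" "card Y = Suc k"
    and "G S \<subseteq> G X" "G T \<subseteq> G X" "G S \<subseteq> G Y" "G T \<subseteq> G Y"
  shows "G X = G Y"
  using flat_join_unique[OF mat flat_G[of S] flat_G[of T] _ _ _ flat_G[of X] _ _ flat_G[of Y], of k]
    assms rk_G by simp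

lemma hexagon:
  assumes "distinct [a, b, c]" "a \<notin> A" "b \<notin> A" "c \<notin> A"
  shows "G (insert a A) \<noteq> G (insert b A) \<Longrightarrow>
      G (insert a (insert b A)) \<noteq> G (insert c (insert b A)) \<Longrightarrow>
      G (insert b A) \<noteq> G (insert c A) \<Longrightarrow>
      G (insert b (insert a A)) \<noteq> G (insert c (insert a A)) \<and>
      G (insert a A) \<noteq> G (insert c A) \<and>
      G (insert a (insert c A)) \<noteq> G (insert b (insert c A))" (is "?P1 \<Longrightarrow> ?P2 \<Longrightarrow> ?P3 \<Longrightarrow> _")
    and "G (insert b (insert a A)) \<noteq> G (insert c (insert a A)) \<Longrightarrow>
      G (insert a A) \<noteq> G (insert c A) \<Longrightarrow>
      G (insert a (insert c A)) \<noteq> G (insert b (insert c A)) \<Longrightarrow>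
      G (insert a A) \<noteq> G (insert b A) \<and>
      G (insert a (insert b A)) \<noteq> G (insert c (insert b A)) \<and>
      G (insert b A) \<noteq> G (insert c A)" (is "?Q1 \<Longrightarrow> ?Q2 \<Longrightarrow> ?Q3 \<Longrightarrow> _")
proof -
  let ?k = "Suc (card A)"
  note [simp] = insert_commute[of b a] insert_commute[of c a] insert_commute[of c b]
  have cd: "card (insert a A) = ?k" "card (insert b A) = ?k" "card (insert c A) = ?k"
    "card (insert a (insert b A)) = Suc ?k" "card (insert a (insert c A)) = Suc ?k"
    "card (insert b (insert c A)) = Suc ?k"
    using assms by auto
  have le: "G (insert a A) \<subseteq> G (insert a (insert b A))" "G (insert a A) \<subseteq> G (insert a (insert c A))"
    "G (insert b A) \<subseteq> G (insert a (insert b A))" "G (insert b A) \<subseteq> G (insert b (insert c A))"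
    "G (insert c A) \<subseteq> G (insert a (insert c A))" "G (insert c A) \<subseteq> G (insert b (insert c A))"
    by (rule mono_G; blast)+
  have ab: "G (insert a A) \<noteq> G (insert b A) \<Longrightarrow> G (insert a A) \<subseteq> G X \<Longrightarrow> G (insert b A) \<subseteq> G X \<Longrightarrow>
      card X = Suc ?k \<Longrightarrow> G X = G (insert a (insert b A))" for X
    by (rule join_unique[of "insert a A" "insert b A" ?k]) (use cd le in auto)
  have ac: "G (insert a A) \<noteq> G (insert c A) \<Longrightarrow> G (insert a A) \<subseteq> G X \<Longrightarrow> G (insert c A) \<subseteq> G X \<Longrightarrow>
      card X = Suc ?k \<Longrightarrow> G X = G (insert a (insert c A))" for X
    by (rule join_unique[of "insert a A" "insert c A" ?k]) (use cd le in auto)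
  have bc: "G (insert b A) \<noteq> G (insert c A) \<Longrightarrow> G (insert b A) \<subseteq> G X \<Longrightarrow> G (insert c A) \<subseteq> G X \<Longrightarrow>
      card X = Suc ?k \<Longrightarrow> G X = G (insert b (insert c A))" for X
    by (rule join_unique[of "insert b A" "insert c A" ?k]) (use cd le in auto)
  { assume P: ?P1 ?P2 ?P3
    have "G (insert a A) \<noteq> G (insert c A)" using P bc[of "insert a (insert b A)"] le cd by auto
    moreover have "G (insert a (insert b A)) \<noteq> G (insert a (insert c A))"
      using P bc[of "insert a (insert b A)"] le cd by auto
    moreover have "G (insert a (insert c A)) \<noteq> G (insert b (insert c A))"
      using P ab[of "insert b (insert c A)"] le cd by auto
    ultimately show "G (insert b (insert a A)) \<noteq> G (insert c (insert a A)) \<and>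
      G (insert a A) \<noteq> G (insert c A) \<and>
      G (insert a (insert c A)) \<noteq> G (insert b (insert c A))" by simp }
  { assume Q: ?Q1 ?Q2 ?Q3
    have "G (insert a A) \<noteq> G (insert b A)" using Q ac[of "insert b (insert c A)"] le cd by auto
    moreover have "G (insert b A) \<noteq> G (insert c A)" using Q ac[of "insert a (insert b A)"] le cd by auto
    moreover have "G (insert a (insert b A)) \<noteq> G (insert b (insert c A))"
      using Q ac[of "insert a (insert b A)"] le cd by auto
    ultimately show "G (insert a A) \<noteq> G (insert b A) \<and>
      G (insert a (insert b A)) \<noteq> G (insert c (insert b A)) \<and>
      G (insert b A) \<noteq> G (insert c A)" by simp }
qed

text \<open>If one geodesic gallery from \<open>x\<^sub>0\<close> to \<open>xs\<close> is compatible then all of them are: two last steps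
  span a square or a hexagon, and compatibility of half of it implies compatibility of the
  other half.\<close>

lemma compatible_geodesic:
  assumes start: "\<forall>p a b s. x0 = p @ b # a # s \<longrightarrow> \<not> \<rho> a < \<rho> b"
  shows "(compatible_ascent G \<rho> ^^ n) x0 (p @ b # a # s) \<Longrightarrow> distinct (p @ b # a # s) \<Longrightarrow> \<rho> a < \<rho> b \<Longrightarrow>
    \<exists>m. n = Suc m \<and> (compatible_ascent G \<rho> ^^ m) x0 (p @ a # b # s) \<and>
      compatible_ascent G \<rho> (p @ a # b # s) (p @ b # a # s)"
proof (induction n arbitrary: p a b s rule: less_induct)
  case (less n)
  let ?C = "compatible_ascent G \<rho>"
  show ?case
  proof (cases n)
    case 0
    then show ?thesis using less.prems start by auto
  next
    case (Suc m)
    obtain ws where ws: "(?C ^^ m) x0 ws" "?C ws (p @ b # a # s)"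
      using less.prems(1) unfolding Suc by (rule relpowp_Suc_E)
    obtain q c d t where q: "ws = q @ c # d # t" "p @ b # a # s = q @ d # c # t" "\<rho> c < \<rho> d"
      "G (insert c (set q)) \<noteq> G (insert d (set q))"
      using ws(2) unfolding compatible_ascent_def by metis
    have mn: "m < n" using Suc by simp
    show ?thesis using q(2)
    proof (cases rule: descents_cases)
      case 1
      then show ?thesis using ws q Suc by auto
    next
      case 2
      have D: "distinct [a, b, c]" "c \<notin> set p" "a \<notin> set p" "b \<notin> set p" using less.prems(2) 2 by auto
      have r: "\<rho> c < \<rho> a" "\<rho> a < \<rho> b" using q(3) less.prems(3) 2 by auto
      obtain m1 where m1: "m = Suc m1" "(?C ^^ m1) x0 (p @ c # b # a # t)"
        "?C (p @ c # b # a # t) (p @ b # c # a # t)"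
        using less.IH[OF mn, of p b c "a # t"] ws(1) q(1) 2 r less.prems(2) by auto
      have "m1 < n" using m1 mn by simp
      then obtain m2 where m2: "m1 = Suc m2" "(?C ^^ m2) x0 (p @ c # a # b # t)"
        "?C (p @ c # a # b # t) (p @ c # b # a # t)"
        using less.IH[of m1 "p @ [c]" b a t] m1 r less.prems(2) 2 by auto
      have e: "G (insert a (insert c (set p))) \<noteq> G (insert b (insert c (set p)))"
        "G (insert c (set p)) \<noteq> G (insert b (set p))"
        "G (insert c (insert b (set p))) \<noteq> G (insert a (insert b (set p)))"
        using m2(3) compatible_ascent_iff[of G \<rho> "p @ [c]" a b t]
          m1(3) compatible_ascent_iff[of G \<rho> p c b "a # t"]
          q(4) 2 by auto
      have h: "G (insert c (set p)) \<noteq> G (insert a (set p))"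
        "G (insert c (insert a (set p))) \<noteq> G (insert b (insert a (set p)))"
        "G (insert a (set p)) \<noteq> G (insert b (set p))"
        using hexagon(2)[of c a b "set p", OF _ _ _ _ e] D by auto
      have s1: "?C (p @ c # a # b # t) (p @ a # c # b # t)"
        using h(1) r compatible_ascent_iff by metis
      have s2: "?C (p @ a # c # b # t) (p @ a # b # c # t)"
        using h(2) r compatible_ascent_iff[of G \<rho> "p @ [a]" c b t] by simp
      have s3: "?C (p @ a # b # c # t) (p @ b # a # c # t)"
        using h(3) r compatible_ascent_iff by metis
      have "(?C ^^ Suc (Suc m2)) x0 (p @ a # b # c # t)"
        by (rule relpowp_Suc_I[OF relpowp_Suc_I[OF m2(2) s1] s2])
      then show ?thesis using s3 m1(1) m2(1) Suc 2 by simp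
    next
      case 3
      have D: "distinct [a, b, d]" "a \<notin> set q" "b \<notin> set q" "d \<notin> set q" using less.prems(2) 3 by auto
      have r: "\<rho> a < \<rho> b" "\<rho> b < \<rho> d" using q(3) less.prems(3) 3 by auto
      obtain m1 where m1: "m = Suc m1" "(?C ^^ m1) x0 (q @ b # a # d # s)"
        "?C (q @ b # a # d # s) (q @ b # d # a # s)"
        using less.IH[OF mn, of "q @ [b]" d a s] ws(1) q(1) 3 r less.prems(2) by auto
      have "m1 < n" using m1 mn by simp
      then obtain m2 where m2: "m1 = Suc m2" "(?C ^^ m2) x0 (q @ a # b # d # s)"
        "?C (q @ a # b # d # s) (q @ b # a # d # s)"
        using less.IH[of m1 q b a "d # s"] m1 r less.prems(2) 3 by auto
      have e: "G (insert a (set q)) \<noteq> G (insert b (set q))"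
        "G (insert a (insert b (set q))) \<noteq> G (insert d (insert b (set q)))"
        "G (insert b (set q)) \<noteq> G (insert d (set q))"
        using m2(3) compatible_ascent_iff[of G \<rho> q a b "d # s"]
          m1(3) compatible_ascent_iff[of G \<rho> "q @ [b]" a d s]
          q(4) 3 by auto
      have h: "G (insert b (insert a (set q))) \<noteq> G (insert d (insert a (set q)))"
        "G (insert a (set q)) \<noteq> G (insert d (set q))"
        "G (insert a (insert d (set q))) \<noteq> G (insert b (insert d (set q)))"
        using hexagon(1)[of a b d "set q", OF _ _ _ _ e] D by auto
      have s1: "?C (q @ a # b # d # s) (q @ a # d # b # s)"
        using h(1) r compatible_ascent_iff[of G \<rho> "q @ [a]" b d s] by simp
      have s2: "?C (q @ a # d # b # s) (q @ d # a # b # s)"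
        using h(2) r less_trans[OF r] compatible_ascent_iff by metis
      have s3: "?C (q @ d # a # b # s) (q @ d # b # a # s)"
        using h(3) r compatible_ascent_iff[of G \<rho> "q @ [d]" a b s] by simp
      have "(?C ^^ Suc (Suc m2)) x0 (q @ d # a # b # s)"
        by (rule relpowp_Suc_I[OF relpowp_Suc_I[OF m2(2) s1] s2])
      then show ?thesis using s3 m1(1) m2(1) Suc 3 by simp
    next
      case (4 v)
      obtain m1 where m1: "m = Suc m1" "(?C ^^ m1) x0 (p @ a # b # v @ c # d # t)"
        "?C (p @ a # b # v @ c # d # t) (p @ b # a # v @ c # d # t)"
        using less.IH[OF mn, of p b a "v @ c # d # t"] ws(1) q(1) 4 less.prems by auto
      have s1: "?C (p @ a # b # v @ c # d # t) (p @ a # b # v @ d # c # t)"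
        using q(3,4) 4 compatible_ascent_iff[of G \<rho> "p @ a # b # v" c d t]
        by (simp add: insert_commute[of b a])
      have s2: "?C (p @ a # b # v @ d # c # t) (p @ b # a # v @ d # c # t)"
        using m1(3) unfolding compatible_ascent_iff .
      show ?thesis using relpowp_Suc_I[OF m1(2) s1] s2 m1(1) Suc 4 by simp
    next
      case (5 v)
      obtain m1 where m1: "m = Suc m1" "(?C ^^ m1) x0 (q @ c # d # v @ a # b # s)"
        "?C (q @ c # d # v @ a # b # s) (q @ c # d # v @ b # a # s)"
        using less.IH[OF mn, of "q @ c # d # v" b a s] ws(1) q(1) 5 less.prems by auto
      have s1: "?C (q @ c # d # v @ a # b # s) (q @ d # c # v @ a # b # s)"
        using q(3,4) unfolding compatible_ascent_iff by blast
      have s2: "?C (q @ d # c # v @ a # b # s) (q @ d # c # v @ b # a # s)"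
        using m1(3) compatible_ascent_iff[of G \<rho> "q @ c # d # v" a b s]
          compatible_ascent_iff[of G \<rho> "q @ d # c # v" a b s]
        by (simp add: insert_commute[of d c])
      show ?thesis using relpowp_Suc_I[OF m1(2) s1] s2 m1(1) Suc 5 by simp
    qed
  qed
qed

lemma compatible_ascent_distinct:
  "(compatible_ascent G \<rho>)\<^sup>*\<^sup>* xs ys \<Longrightarrow> distinct xs \<Longrightarrow> distinct ys"
  by (induction rule: rtranclp_induct) (auto simp: compatible_ascent_def)

lemma compatible_swap_ascents:
  assumes start: "\<forall>p a b s. x0 = p @ b # a # s \<longrightarrow> \<not> \<rho> a < \<rho> b"
    and inj: "inj \<rho>" and dist: "distinct x0" and "(compatible_swap G)\<^sup>*\<^sup>* x0 xs"
  shows "(compatible_ascent G \<rho>)\<^sup>*\<^sup>* x0 xs"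
  using assms(4)
proof (induction rule: rtranclp_induct)
  case (step xs ys)
  obtain p a b s where *: "xs = p @ a # b # s" "ys = p @ b # a # s"
    "G (insert a (set p)) \<noteq> G (insert b (set p))"
    using step.hyps(2) unfolding compatible_swap_def by blast
  then have "\<rho> a \<noteq> \<rho> b" using inj by (auto simp: inj_def)
  then consider "\<rho> a < \<rho> b" | "\<rho> b < \<rho> a" by linarith
  then show ?case
  proof cases
    case 1
    then have "compatible_ascent G \<rho> xs ys" using * unfolding compatible_ascent_def by blast
    with step.IH show ?thesis by (rule rtranclp.rtrancl_into_rtrancl)
  next
    case 2
    obtain n where "(compatible_ascent G \<rho> ^^ n) x0 xs" using step.IH rtranclp_imp_relpowp by metis
    then obtain m where "(compatible_ascent G \<rho> ^^ m) x0 ys"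
      using compatible_geodesic[of x0 \<rho> n p a b s, OF start] 2 * compatible_ascent_distinct[OF step.IH dist]
      by auto
    then show ?thesis by (rule relpowp_imp_rtranclp)
  qed
qed simp

lemma compatible_if_connected:
  assumes dist: "distinct (p @ a # b # s)" and univ: "set (p @ a # b # s) = UNIV"
    and conn: "(compatible_swap G)\<^sup>*\<^sup>* (p @ a # b # s) (p @ b # a # s)"
  shows "G (insert a (set p)) \<noteq> G (insert b (set p))"
proof -
  let ?x = "p @ a # b # s"
  define \<rho> where "\<rho> x = length (takeWhile (\<lambda>y. y \<noteq> x) ?x)" for x
  have \<rho>: "\<rho> x = length q" if "?x = q @ x # t" for q x t
  proof -
    have "x \<notin> set q" using dist unfolding that by simp
    then have "takeWhile (\<lambda>y. y \<noteq> x) (q @ x # t) = q" by (auto simp: takeWhile_eq_all_conv[THEN iffD2] takeWhile_append)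
    then show ?thesis unfolding \<rho>_def that by simp
  qed
  have nth: "?x ! \<rho> x = x" for x
  proof -
    obtain q t where *: "?x = q @ x # t" using univ split_list[of x ?x] by blast
    show ?thesis unfolding \<rho>[OF *] unfolding * by simp
  qed
  have inj: "inj \<rho>" by (rule injI) (metis nth)
  have "\<not> \<rho> d < \<rho> c" if "?x = q @ c # d # t" for q c d t
    using \<rho>[OF that] \<rho>[of "q @ [c]" d t] that by simp
  then have start: "\<forall>p a b s. ?x = p @ b # a # s \<longrightarrow> \<not> \<rho> a < \<rho> b" by blast
  have "(compatible_ascent G \<rho>)\<^sup>*\<^sup>* ?x (p @ b # a # s)"
    by (rule compatible_swap_ascents[OF start inj dist conn])
  then obtain n where "(compatible_ascent G \<rho> ^^ n) ?x (p @ b # a # s)" using rtranclp_imp_relpowp by metis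
  moreover have "\<rho> a < \<rho> b" using \<rho>[of p a "b # s"] \<rho>[of "p @ [a]" b s] by simp
  moreover have "distinct (p @ b # a # s)" using dist by auto
  ultimately have "compatible_ascent G \<rho> (p @ a # b # s) (p @ b # a # s)"
    using compatible_geodesic[of ?x \<rho> n p b a s, OF start] by blast
  then show ?thesis unfolding compatible_ascent_iff by blast
qed

lemma basis_if_all_compatible:
  assumes r: "rk I UNIV = CARD('r)"
    and point: "\<And>j. \<exists>e. G {j} = cl I {e}"
    and compat: "\<And>A j k. j \<notin> A \<Longrightarrow> k \<notin> A \<Longrightarrow> j \<noteq> k \<Longrightarrow> G (insert j A) \<noteq> G (insert k A)"
  obtains b where "ordered_basis I b" "\<And>S. G S = cl I (b ` S)"
proof -
  obtain b where b: "\<And>j. G {j} = cl I {b j}" using point by metis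
  have bG: "b ` S \<subseteq> G S" for S
  proof
    fix e assume "e \<in> b ` S"
    then obtain j where j: "j \<in> S" "e = b j" by blast
    then have "e \<in> G {j}" using b cl_superset[OF mat, of "{b j}"] by blast
    then show "e \<in> G S" using mono_G[of "{j}" S] j by blast
  qed
  have rk_b: "card S \<le> rk I (b ` S)" for S
  proof (induction "card S" arbitrary: S rule: less_induct)
    case less
    consider "S = {}" | j where "S = {j}" | j k A where "S = insert j (insert k A)" "j \<noteq> k" "j \<notin> A" "k \<notin> A"
    proof (cases "\<exists>j k. j \<in> S \<and> k \<in> S \<and> j \<noteq> k")
      case True
      then obtain j k where "j \<in> S" "k \<in> S" "j \<noteq> k" by blast
      then show ?thesis using that(3)[of j k "S - {j, k}"] by blast
    next
      case False
      then show ?thesis using that(1,2) by blast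
    qed
    then show ?case
    proof cases
      case 2
      then show ?thesis using rk_G[of "{j}"] rk_cl[OF mat, of "{b j}"] b by simp
    next
      case (3 j k A)
      have eq: "G T = cl I (b ` T)" if "card T < card S" for T
        using cl_eq_flat[OF mat flat_G bG, of T] less[OF that] rk_G by simp
      have c: "card (insert j A) < card S" "card (insert k A) < card S" using 3 by auto
      have "card S = Suc (card (insert j A))" using 3 by simp
      also have "\<dots> \<le> rk I (G (insert j A) \<union> G (insert k A))"
        by (rule rk_union_flats[OF mat flat_G flat_G]) (use 3 rk_G compat in auto)
      also have "\<dots> \<le> rk I (cl I (b ` S))"
        unfolding eq[OF c(1)] eq[OF c(2)]
        by (intro rk_mono[OF mat] Un_least cl_mono[OF mat]) (use 3 in auto)
      finally show ?thesis by (simp add: rk_cl[OF mat])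
    qed simp
  qed
  have eq: "G S = cl I (b ` S)" for S
    using cl_eq_flat[OF mat flat_G bG, of S] rk_b rk_G by simp
  have le: "CARD('r) \<le> rk I (range b)" using rk_b[of UNIV] by simp
  then have card: "card (range b) = CARD('r)"
    using rk_le_card[OF mat, of "range b"] card_image_le[of UNIV b] by simp
  then have "inj b" by (simp add: eq_card_imp_inj_on)
  moreover have "range b \<in> I"
    using indep_if_rk_eq_card[OF mat] le card rk_le_card[OF mat, of "range b"] by simp
  then have "basis I (range b)" using indep_card_basis[OF mat] card r by simp
  ultimately have "ordered_basis I b" by (simp add: ordered_basis_def)
  then show thesis using that eq by blast
qed

end

section \<open>Full flags as orderings\<close>

definition prefix_flag :: "'r list \<Rightarrow> 'r set list" where
  "prefix_flag xs = map (\<lambda>i. set (take i xs)) [0..<Suc (length xs)]"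

lemma length_prefix_flag: "length (prefix_flag xs) = Suc (length xs)"
  by (simp add: prefix_flag_def)

lemma nth_prefix_flag: "i \<le> length xs \<Longrightarrow> prefix_flag xs ! i = set (take i xs)"
  unfolding prefix_flag_def by (subst nth_map) (auto simp del: upt_Suc)

lemma length_enumeration:
  fixes xs :: "'r::finite list"
  shows "distinct xs \<Longrightarrow> set xs = UNIV \<Longrightarrow> length xs = CARD('r)"
  by (metis distinct_card)

lemma card_set_take: "distinct xs \<Longrightarrow> i \<le> length xs \<Longrightarrow> card (set (take i xs)) = i"
  by (simp add: distinct_card)

lemma full_flag_prefix_flag:
  fixes xs :: "'r::finite list"
  assumes "distinct xs" "set xs = UNIV"
  shows "full_flag (prefix_flag xs)"
proof -
  have "set (take i xs) \<subset> set (take j xs)" if "i < j" "j \<le> length xs" for i j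
  proof (rule psubsetI)
    show "set (take i xs) \<subseteq> set (take j xs)" using that by (intro set_take_subset_set_take) simp
    show "set (take i xs) \<noteq> set (take j xs)"
      using that card_set_take[OF assms(1), of i] card_set_take[OF assms(1), of j] by auto
  qed
  then have "sorted_wrt (\<subset>) (prefix_flag xs)"
    unfolding sorted_wrt_iff_nth_less by (auto simp: length_prefix_flag nth_prefix_flag)
  moreover have "prefix_flag xs \<noteq> []" using length_prefix_flag[of xs] by auto
  moreover have "last (prefix_flag xs) = UNIV"
    using assms by (simp add: last_conv_nth calculation length_prefix_flag nth_prefix_flag)
  moreover have "hd (prefix_flag xs) = {}"
    by (simp add: hd_conv_nth calculation nth_prefix_flag)
  ultimately show ?thesis
    unfolding full_flag_def is_flag_def using length_enumeration[OF assms] by (simp add: length_prefix_flag)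
qed

lemma full_flag_nth:
  fixes W :: "'r::finite set list"
  assumes "full_flag W"
  shows "i < j \<Longrightarrow> j \<le> CARD('r) \<Longrightarrow> W ! i \<subset> W ! j"
    and "i \<le> CARD('r) \<Longrightarrow> card (W ! i) = i"
    and "W ! 0 = {}" and "W ! CARD('r) = UNIV"
proof -
  have l: "length W = Suc CARD('r)" "W \<noteq> []" and s: "sorted_wrt (\<subset>) W"
    and h: "hd W = {}" "last W = UNIV"
    using assms by (auto simp: full_flag_def is_flag_def)
  show sub: "W ! i \<subset> W ! j" if "i < j" "j \<le> CARD('r)" for i j
    using s l that by (auto simp: sorted_wrt_iff_nth_less)
  have step: "j \<le> CARD('r) \<Longrightarrow> i \<le> j \<Longrightarrow> card (W ! i) + (j - i) \<le> card (W ! j)" for i j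
  proof (induction j)
    case (Suc j)
    show ?case
    proof (cases "i \<le> j")
      case True
      have "card (W ! j) < card (W ! Suc j)" using sub[of j "Suc j"] Suc.prems by (intro psubset_card_mono) auto
      then show ?thesis using Suc True by auto
    next
      case False
      then show ?thesis using Suc.prems by (simp add: le_Suc_eq)
    qed
  qed simp
  show "card (W ! i) = i" if "i \<le> CARD('r)"
    using step[OF that, of 0] step[of "CARD('r)" i] that card_mono[of UNIV "W ! CARD('r)"] by simp
  show "W ! 0 = {}" using h l by (simp add: hd_conv_nth)
  show "W ! CARD('r) = UNIV" using h l by (simp add: last_conv_nth)
qed

lemma full_flag_obtain_enumeration:
  fixes W :: "'r::finite set list"
  assumes "full_flag W"
  obtains xs where "distinct xs" "set xs = UNIV" "W = prefix_flag xs"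
proof -
  note W = full_flag_nth[OF assms]
  have "\<exists>x. W ! Suc i = insert x (W ! i)" if "i < CARD('r)" for i
  proof -
    have "card (W ! Suc i - W ! i) = 1"
      using W(1)[of i "Suc i"] W(2)[of i] W(2)[of "Suc i"] that by (subst card_Diff_subset) auto
    then obtain x where "W ! Suc i - W ! i = {x}" by (metis card_1_singletonE)
    then have "W ! Suc i = insert x (W ! i)" using W(1)[of i "Suc i"] that by auto
    then show ?thesis ..
  qed
  then obtain f where f: "\<And>i. i < CARD('r) \<Longrightarrow> W ! Suc i = insert (f i) (W ! i)" by metis
  define xs where "xs = map f [0..<CARD('r)]"
  have len: "length xs = CARD('r)" by (simp add: xs_def)
  have t: "set (take i xs) = W ! i" if "i \<le> CARD('r)" for i
    using that
  proof (induction i)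
    case (Suc i)
    then show ?case using f[of i] by (simp add: take_Suc_conv_app_nth len) (simp add: xs_def)
  qed (simp add: W)
  have u: "set xs = UNIV" using t[of "CARD('r)"] W(4) len by simp
  then have d: "distinct xs" using len by (metis card_distinct)
  have "W = prefix_flag xs"
    using assms t by (intro nth_equalityI) (auto simp: length_prefix_flag nth_prefix_flag len full_flag_def)
  then show thesis using that d u by blast
qed

lemma set_take_Suc_nth:
  "i < length xs \<Longrightarrow> set (take (Suc i) xs) = insert (xs ! i) (set (take i xs))"
  by (simp add: take_Suc_conv_app_nth)

lemma nth_notin_take: "distinct xs \<Longrightarrow> i < length xs \<Longrightarrow> xs ! i \<notin> set (take i xs)"
  by (auto simp: in_set_conv_nth nth_eq_iff_index_eq)

lemma nth_eq_if_take_sets_eq: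
  assumes "distinct xs" "distinct ys" "i < length xs" "i < length ys"
    and "set (take i xs) = set (take i ys)" "set (take (Suc i) xs) = set (take (Suc i) ys)"
  shows "xs ! i = ys ! i"
  using assms set_take_Suc_nth[of i xs] set_take_Suc_nth[of i ys]
    nth_notin_take[of xs i] nth_notin_take[of ys i] by auto

lemma prefix_flag_inject:
  assumes "distinct xs" "distinct ys" "prefix_flag xs = prefix_flag ys"
  shows "xs = ys"
proof (rule nth_equalityI)
  show len: "length xs = length ys" using assms(3) length_prefix_flag by (metis nat.inject)
  have t: "set (take i xs) = set (take i ys)" if "i \<le> length xs" for i
    using that len assms(3) nth_prefix_flag by metis
  show "xs ! i = ys ! i" if "i < length xs" for i
    using that len t[of i] t[of "Suc i"] by (intro nth_eq_if_take_sets_eq[OF assms(1,2)]) auto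
qed

lemma permutohedron_edge_swap:
  fixes p :: "'r::finite list"
  assumes "distinct (p @ a # b # s)" "set (p @ a # b # s) = UNIV"
  shows "permutohedron_edge (prefix_flag (p @ a # b # s)) (prefix_flag (p @ b # a # s))"
proof -
  let ?x = "p @ a # b # s" and ?y = "p @ b # a # s"
  have y: "distinct ?y" "set ?y = UNIV" using assms by auto
  have "{i. i \<le> CARD('r) \<and> prefix_flag ?x ! i \<noteq> prefix_flag ?y ! i} = {Suc (length p)}"
    (is "?S = _")
  proof -
    have "i \<in> ?S \<longleftrightarrow> i \<le> CARD('r) \<and> set (take i ?x) \<noteq> set (take i ?y)" for i
      using length_enumeration[OF assms] length_enumeration[OF y] by (auto simp: nth_prefix_flag)
    moreover have "set (take i ?x) = set (take i ?y)" if "i \<noteq> Suc (length p)" for i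
    proof (cases "i \<le> length p")
      case False
      then have "i = length p + Suc (Suc (i - length p - 2))" using that by arith
      then obtain k where "i = length p + Suc (Suc k)" ..
      then show ?thesis by auto
    qed simp
    moreover have "set (take (Suc (length p)) ?x) \<noteq> set (take (Suc (length p)) ?y)"
      using assms by auto
    moreover have "Suc (length p) \<le> CARD('r)" using length_enumeration[OF assms] by simp
    ultimately show ?thesis by auto
  qed
  then show ?thesis unfolding permutohedron_edge_def
    using full_flag_prefix_flag[OF assms] full_flag_prefix_flag[OF y] by simp
qed

lemma permutohedron_edge_obtain_swap:
  fixes xs ys :: "'r::finite list"
  assumes x: "distinct xs" "set xs = UNIV" and y: "distinct ys" "set ys = UNIV"
    and "permutohedron_edge (prefix_flag xs) (prefix_flag ys)"
  obtains p a b s where "xs = p @ a # b # s" "ys = p @ b # a # s"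
proof -
  have lx: "length xs = CARD('r)" and ly: "length ys = CARD('r)"
    using length_enumeration x y by auto
  have "card {i. i \<le> CARD('r) \<and> prefix_flag xs ! i \<noteq> prefix_flag ys ! i} = 1"
    using assms(5) unfolding permutohedron_edge_def by blast
  then obtain k where k: "{i. i \<le> CARD('r) \<and> prefix_flag xs ! i \<noteq> prefix_flag ys ! i} = {k}"
    by (rule card_1_singletonE)
  have eq: "set (take i xs) = set (take i ys)" if "i \<le> CARD('r)" "i \<noteq> k" for i
  proof -
    have "prefix_flag xs ! i = prefix_flag ys ! i" using k that by blast
    then show ?thesis using that lx ly by (simp add: nth_prefix_flag)
  qed
  have kr: "k \<le> CARD('r)" and neq: "set (take k xs) \<noteq> set (take k ys)"
  proof -
    have "k \<in> {i. i \<le> CARD('r) \<and> prefix_flag xs ! i \<noteq> prefix_flag ys ! i}" using k by simp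
    then show "k \<le> CARD('r)" "set (take k xs) \<noteq> set (take k ys)" using lx ly by (auto simp: nth_prefix_flag)
  qed
  have "k \<noteq> 0" "k \<noteq> CARD('r)" using neq x y lx ly by (auto intro: ccontr)
  then obtain l where l: "k = Suc l" "Suc l < CARD('r)" using kr by (cases k) auto
  have nth: "xs ! i = ys ! i" if "i < CARD('r)" "i \<noteq> l" "i \<noteq> Suc l" for i
    using eq[of i] eq[of "Suc i"] that l lx ly by (intro nth_eq_if_take_sets_eq[OF x(1) y(1)]) auto
  have split: "zs = take l zs @ zs ! l # zs ! Suc l # drop (Suc (Suc l)) zs" if "length zs = CARD('r)"
    for zs :: "'r list"
    using l(2) that by (metis Cons_nth_drop_Suc Suc_lessD append_take_drop_id)
  have p: "take l xs = take l ys" using nth l lx ly by (intro nth_equalityI) auto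
  have s: "drop (Suc (Suc l)) xs = drop (Suc (Suc l)) ys" using nth l lx ly by (intro nth_equalityI) auto
  have set2: "set (take (Suc (Suc l)) xs) = set (take (Suc (Suc l)) ys)" using eq[of "Suc (Suc l)"] l by simp
  have ne: "xs ! l \<noteq> ys ! l"
    using neq set_take_Suc_nth[of l xs] set_take_Suc_nth[of l ys] l lx ly p by auto
  have "xs ! l \<notin> set (take l ys)" and "ys ! l \<notin> set (take l xs)"
    using nth_notin_take[OF x(1), of l] nth_notin_take[OF y(1), of l] p l lx ly by auto
  moreover have "set (take (Suc (Suc l)) xs) = {xs ! l, xs ! Suc l} \<union> set (take l xs)"
    "set (take (Suc (Suc l)) ys) = {ys ! l, ys ! Suc l} \<union> set (take l ys)"
    using set_take_Suc_nth[of l xs] set_take_Suc_nth[of l ys]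
      set_take_Suc_nth[of "Suc l" xs] set_take_Suc_nth[of "Suc l" ys] l lx ly by auto
  ultimately have "xs ! l = ys ! Suc l" "ys ! l = xs ! Suc l" using set2 ne ne[symmetric] by blast+
  then show thesis using that[of "take l xs" "xs ! l" "xs ! Suc l" "drop (Suc (Suc l)) xs"]
      split[OF lx] split[OF ly] p s by metis
qed

section \<open>Flag cones\<close>

lemma flag_cone_mono:
  fixes W :: "'r::finite set list"
  assumes W: "full_flag W" and z: "z \<in> flag_cone W" and i: "i \<le> CARD('r)" "j \<in> W ! i" "k \<notin> W ! i"
  shows "z $ k \<le> z $ j"
proof -
  let ?D = "{x::real ^ 'r. (axis j 1 - axis k 1) \<bullet> x \<ge> 0}"
  have D: "x \<in> ?D \<longleftrightarrow> x $ k \<le> x $ j" for x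
    by (simp add: inner_diff_left inner_axis')
  obtain x y where zxy: "z = x + y"
    and x: "x \<in> convex_cone hull {ind_vec (W ! i) | i. 1 \<le> i \<and> i < length W - 1}"
    and y: "y \<in> span {ind_vec UNIV}"
    using z unfolding flag_cone_def by blast
  have "ind_vec (W ! m) \<in> ?D" if m: "m < length W - 1" for m
  proof -
    have mr: "m \<le> CARD('r)" using m W by (simp add: full_flag_def)
    have "W ! m \<subseteq> W ! i \<or> W ! i \<subseteq> W ! m"
      using full_flag_nth(1)[OF W, of m i] full_flag_nth(1)[OF W, of i m] mr i
      by (cases m i rule: linorder_cases) auto
    then have "k \<in> W ! m \<longrightarrow> j \<in> W ! m" using i by blast
    then show ?thesis unfolding D by (auto simp: ind_vec_def indicator_def)
  qed
  then have "convex_cone hull {ind_vec (W ! i) | i. 1 \<le> i \<and> i < length W - 1} \<subseteq> ?D"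
    by (intro hull_minimal convex_cone_halfspace_ge) auto
  then have "x $ k \<le> x $ j" using x D by blast
  moreover obtain c where "y = c *\<^sub>R ind_vec UNIV" using y by (auto simp: span_singleton)
  then have "y $ k = y $ j" by (simp add: ind_vec_def)
  ultimately show ?thesis using zxy by simp
qed

lemma sum_mem_convex_cone_hull:
  "finite A \<Longrightarrow> (\<And>i. i \<in> A \<Longrightarrow> f i \<in> convex_cone hull S) \<Longrightarrow> sum f A \<in> convex_cone hull S"
  by (induction rule: finite_induct) (auto simp: convex_cone_hull_contains_0 convex_cone_hull_add)

lemma sorted_mem_flag_cone:
  fixes xs :: "'r::finite list" and z :: "real ^ 'r"
  assumes x: "distinct xs" "set xs = UNIV" and z: "sorted (map (\<lambda>j. - z $ j) xs)"
  shows "z \<in> flag_cone (prefix_flag xs)"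
proof -
  have len: "length xs = CARD('r)" by (rule length_enumeration[OF x])
  then obtain r where r: "length xs = Suc r" by (metis gr0_implies_Suc zero_less_card_finite)
  define f where "f i = z $ (xs ! i)" for i
  have f: "f k \<le> f i" if "i \<le> k" "k < length xs" for i k
    using z that unfolding f_def sorted_iff_nth_mono by fastforce
  define y where "y = (\<Sum>i=1..<Suc r. (f (i - 1) - f i) *\<^sub>R ind_vec (prefix_flag xs ! i))"
  let ?H = "convex_cone hull {ind_vec (prefix_flag xs ! i) | i. 1 \<le> i \<and> i < length (prefix_flag xs) - 1}"
  have "y \<in> ?H" unfolding y_def
  proof (rule sum_mem_convex_cone_hull)
    fix i assume "i \<in> {1..<Suc r}"
    then have i: "1 \<le> i" "i < Suc r" by auto
    show "(f (i - 1) - f i) *\<^sub>R ind_vec (prefix_flag xs ! i) \<in> ?H"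
    proof (rule convex_cone_hull_mul)
      show "ind_vec (prefix_flag xs ! i) \<in> ?H"
        by (rule hull_inc) (use i r in \<open>auto simp: length_prefix_flag\<close>)
      show "0 \<le> f (i - 1) - f i" using f[of "i - 1" i] i r by simp
    qed
  qed simp
  moreover have "f r *\<^sub>R ind_vec UNIV \<in> span {ind_vec UNIV :: real ^ 'r}"
    by (simp add: span_base span_scale)
  moreover have "z = y + f r *\<^sub>R ind_vec UNIV"
  proof (rule vec_eq_iff[THEN iffD2], rule allI)
    fix j
    obtain m where m: "j = xs ! m" "m < Suc r" using x(2) r by (metis UNIV_I in_set_conv_nth)
    have mem: "j \<in> set (take i xs) \<longleftrightarrow> m < i" if "i < Suc r" for i
      using m x(1) r that by (auto simp: in_set_conv_nth nth_eq_iff_index_eq)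
    have "y $ j = (\<Sum>i=1..<Suc r. if m < i then f (i - 1) - f i else 0)"
      unfolding y_def sum_component
      by (rule sum.cong[OF refl]) (use mem r in \<open>simp add: ind_vec_def nth_prefix_flag indicator_def\<close>)
    also have "\<dots> = (\<Sum>i=Suc m..<Suc r. f (i - 1) - f i)"
      by (rule sum.mono_neutral_cong_right) auto
    also have "\<dots> = (\<Sum>i=m..<r. f i - f (Suc i))"
      by (subst sum.shift_bounds_Suc_ivl) simp
    also have "\<dots> = f m - f r"
      using sum_Suc_diff'[of m r "\<lambda>i. - f i"] m(2) by simp
    finally show "z $ j = (y + f r *\<^sub>R ind_vec UNIV) $ j"
      using m by (simp add: ind_vec_def f_def)
  qed
  ultimately show ?thesis unfolding flag_cone_def by blast
qed

lemma mem_flag_cone_iff_sorted: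
  fixes xs :: "'r::finite list" and z :: "real ^ 'r"
  assumes x: "distinct xs" "set xs = UNIV"
  shows "z \<in> flag_cone (prefix_flag xs) \<longleftrightarrow> sorted (map (\<lambda>j. - z $ j) xs)"
proof
  assume z: "z \<in> flag_cone (prefix_flag xs)"
  have "z $ (xs ! k) \<le> z $ (xs ! i)" if "i < k" "k < length xs" for i k
  proof (rule flag_cone_mono[OF full_flag_prefix_flag[OF x] z, of k])
    show "k \<le> CARD('r)" using that length_enumeration[OF x] by simp
    show "xs ! i \<in> prefix_flag xs ! k" using that by (auto simp: nth_prefix_flag in_set_conv_nth)
    show "xs ! k \<notin> prefix_flag xs ! k" using that nth_notin_take[OF x(1)] by (simp add: nth_prefix_flag)
  qed
  then show "sorted (map (\<lambda>j. - z $ j) xs)" by (simp add: sorted_iff_nth_mono_less)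
qed (rule sorted_mem_flag_cone[OF x])

lemma flag_cones_cover: "\<exists>W. full_flag W \<and> z \<in> flag_cone W"
proof -
  obtain l :: "'a list" where l: "set l = UNIV" "distinct l" using finite_distinct_list[of "UNIV :: 'a set"] by auto
  let ?x = "sort_key (\<lambda>j. - z $ j) l"
  have "distinct ?x" "set ?x = UNIV" using l by auto
  then show ?thesis using full_flag_prefix_flag sorted_mem_flag_cone sorted_sort_key by metis
qed

lemma flag_cone_generic_point:
  fixes xs :: "'r::finite list"
  assumes x: "distinct xs" "set xs = UNIV"
  obtains z :: "real ^ 'r" where "inj (($) z)" "z \<in> flag_cone (prefix_flag xs)"
    "\<And>W. full_flag W \<Longrightarrow> z \<in> flag_cone W \<Longrightarrow> W = prefix_flag xs"
proof -
  have "\<forall>j. \<exists>m. m < length xs \<and> xs ! m = j" using x(2) by (metis UNIV_I in_set_conv_nth)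
  then obtain ix where ix: "\<And>j. ix j < length xs \<and> xs ! ix j = j" by metis
  have ix_nth: "ix (xs ! m) = m" if "m < length xs" for m
    using ix[of "xs ! m"] that nth_eq_iff_index_eq[OF x(1), of "ix (xs ! m)" m] by blast
  define z :: "real ^ 'r" where "z = (\<chi> j. - real (ix j))"
  have inj: "inj (($) z)" by (rule injI) (simp add: z_def, metis ix)
  have s: "sorted (map (\<lambda>j. - z $ j) xs)"
    by (auto simp: sorted_iff_nth_mono_less z_def ix_nth)
  have "W = prefix_flag xs" if W: "full_flag W" "z \<in> flag_cone W" for W
  proof -
    obtain ys where y: "distinct ys" "set ys = UNIV" "W = prefix_flag ys"
      using full_flag_obtain_enumeration[OF W(1)] .
    have "sorted (map (\<lambda>j. - z $ j) ys)" using W y mem_flag_cone_iff_sorted by metis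
    then have "map (\<lambda>j. - z $ j) ys = map (\<lambda>j. - z $ j) xs"
      using s x y inj by (intro sorted_distinct_set_unique) (auto simp: distinct_map inj_def inj_on_def)
    then have "ys = xs" using inj by (subst (asm) inj_map_eq_map) (auto simp: inj_def)
    then show ?thesis using y by simp
  qed
  then show thesis using that inj sorted_mem_flag_cone[OF x s] by blast
qed

section \<open>Flags of points\<close>

lemma superlevel_set_iff:
  fixes v :: "'r::finite \<Rightarrow> real"
  shows "(\<exists>l. S = {j. l \<le> v j}) \<longleftrightarrow> (\<forall>i\<in>S. \<forall>j\<in>-S. v j < v i)"
proof
  assume R: "\<forall>i\<in>S. \<forall>j\<in>-S. v j < v i"
  show "\<exists>l. S = {j. l \<le> v j}"
  proof (cases "S = {}")
    case True
    have "v j < Max (range v) + 1" for j by (rule le_less_trans[OF Max_ge[of "range v" "v j"]]) auto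
    then have "{j. Max (range v) + 1 \<le> v j} = {}" by (auto simp: not_le)
    then show ?thesis using True by metis
  next
    case False
    have "S = {j. Min (v ` S) \<le> v j}"
    proof (intro equalityI subsetI CollectI)
      fix j assume "j \<in> {j. Min (v ` S) \<le> v j}"
      moreover obtain i where "i \<in> S" "v i = Min (v ` S)"
      proof -
        have "Min (v ` S) \<in> v ` S" using False by (intro Min_in) auto
        then show thesis using that by (metis imageE)
      qed
      ultimately show "j \<in> S" using R by force
    qed auto
    then show ?thesis by blast
  qed
qed force

lemma mem_flag_at_superlevel:
  assumes "S \<in> set (flag_at u x)" shows "\<forall>i\<in>S. \<forall>j\<in>-S. u j \<bullet> x < u i \<bullet> x"
  using assms unfolding flag_at_def by auto

lemma flag_at_eq_prefix_flag:
  fixes u :: "'r::finite \<Rightarrow> 'a::euclidean_space"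
  assumes x: "distinct xs" "set xs = UNIV" and inj: "inj (\<lambda>j. u j \<bullet> y)"
    and s: "sorted (map (\<lambda>j. - (u j \<bullet> y)) xs)"
  shows "flag_at u y = prefix_flag xs"
proof -
  let ?v = "\<lambda>j. u j \<bullet> y"
  have s': "sorted (rev (map ?v xs))"
    using s by (auto simp: sorted_iff_nth_mono_less rev_nth)
  have "sorted_list_of_set (set (rev (map ?v xs))) = rev (map ?v xs)"
    by (rule sorted_list_of_set.idem_if_sorted_distinct)
      (use s' x inj in \<open>auto simp: distinct_map inj_def inj_on_def\<close>)
  then have fl: "flag_at u y = {} # map (\<lambda>i. {j. ?v i \<le> ?v j}) xs"
    unfolding flag_at_def using x by (simp add: comp_def)
  have lt: "?v (xs ! m) < ?v (xs ! k)" if "k < m" "m < length xs" for k m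
  proof -
    have "?v (xs ! m) \<le> ?v (xs ! k)" using s that by (auto simp: sorted_iff_nth_mono_less)
    moreover have "?v (xs ! m) \<noteq> ?v (xs ! k)"
      using inj that x(1) by (metis injD less_irrefl nth_eq_iff_index_eq order_less_trans)
    ultimately show ?thesis by simp
  qed
  have "{j. ?v (xs ! m) \<le> ?v j} = set (take (Suc m) xs)" if m: "m < length xs" for m
  proof (intro equalityI subsetI)
    fix j assume j: "j \<in> {j. ?v (xs ! m) \<le> ?v j}"
    obtain k where k: "k < length xs" "j = xs ! k" using x(2) by (metis UNIV_I in_set_conv_nth)
    then have "k \<le> m" using lt[of m k] j by (metis leI mem_Collect_eq not_le)
    then show "j \<in> set (take (Suc m) xs)" using k m by (auto simp: in_set_conv_nth intro!: exI[of _ k])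
  next
    fix j assume "j \<in> set (take (Suc m) xs)"
    then obtain k where "k < Suc m" "j = xs ! k" using m by (auto simp: in_set_conv_nth)
    then show "j \<in> {j. ?v (xs ! m) \<le> ?v j}" using lt[of k m] m by (cases "k = m") auto
  qed
  then show ?thesis unfolding fl
    by (intro nth_equalityI) (auto simp: length_prefix_flag nth_prefix_flag nth_Cons split: nat.split)
qed

section \<open>Values and permutations of characters\<close>

lemma affinely_independent_values:
  fixes u :: "'r::finite \<Rightarrow> 'a::euclidean_space" and z :: "'r \<Rightarrow> real"
  assumes ind: "affinely_independent u" and u: "\<And>j. u j \<in> span N"
  obtains x c where "x \<in> span N" "\<And>j. u j \<bullet> x = z j + c"
proof -
  obtain j0 :: 'r where True by blast
  have inj: "inj u" and "\<not> affine_dependent (range u)" using ind by (auto simp: affinely_independent_def)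
  then have indep: "independent ((\<lambda>x. - u j0 + x) ` (range u - {u j0}))"
    using affine_dependent_iff_dependent2[of "u j0" "range u"] by blast
  obtain f :: "'a \<Rightarrow> real" where lin: "linear f"
    and f: "\<And>w. w \<in> (\<lambda>x. - u j0 + x) ` (range u - {u j0}) \<Longrightarrow> f w = z (inv u (u j0 + w)) - z j0"
    using linear_independent_extend[OF indep, of "\<lambda>w. z (inv u (u j0 + w)) - z j0"] by blast
  have fu: "f (u j) = z j + (f (u j0) - z j0)" for j
  proof (cases "j = j0")
    case False
    then have "f (- u j0 + u j) = z j - z j0"
      using f[of "- u j0 + u j"] inj by (auto simp: inj_eq)
    then show ?thesis using linear_diff[OF lin, of "u j" "u j0"] by simp
  qed simp
  obtain x w where xw: "x \<in> span N" "\<And>y. y \<in> span N \<Longrightarrow> orthogonal w y" "adjoint f 1 = x + w"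
    using orthogonal_subspace_decomp_exists[of N "adjoint f 1"] by metis
  have "u j \<bullet> x = z j + (f (u j0) - z j0)" for j
  proof -
    have "u j \<bullet> w = 0" using xw(2)[OF u[of j]] by (simp add: orthogonal_def inner_commute)
    moreover have "u j \<bullet> adjoint f 1 = f (u j)" using adjoint_works[OF lin, of "u j" 1] by simp
    ultimately show ?thesis unfolding xw(3) fu[of j, symmetric] by (simp add: inner_add_right)
  qed
  then show thesis using that xw(1) by blast
qed

lemma generic_point_avoiding_hyperplanes:
  fixes D :: "'a::real_inner set"
  assumes "finite D" "subspace V" "D \<subseteq> V" "0 \<notin> D"
  obtains x where "x \<in> V" "\<And>d. d \<in> D \<Longrightarrow> d \<bullet> x \<noteq> 0"
proof -
  have "\<exists>x\<in>V. \<forall>d\<in>D. d \<bullet> x \<noteq> 0" using assms(1,3,4)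
  proof (induction rule: finite_induct)
    case empty
    then show ?case using subspace_0[OF assms(2)] by auto
  next
    case (insert d D)
    then obtain x where x: "x \<in> V" "\<forall>d\<in>D. d \<bullet> x \<noteq> 0" by auto
    let ?bad = "(\<lambda>e. - (e \<bullet> x) / (e \<bullet> d)) ` insert d D"
    obtain t where t: "t \<notin> ?bad" using insert ex_new_if_finite[OF infinite_UNIV_char_0, of ?bad] by auto
    have "e \<bullet> (x + t *\<^sub>R d) \<noteq> 0" if e: "e \<in> insert d D" for e
    proof
      assume *: "e \<bullet> (x + t *\<^sub>R d) = 0"
      then have **: "e \<bullet> x + t * (e \<bullet> d) = 0" by (simp add: inner_add_right)
      show False
      proof (cases "e \<bullet> d = 0")
        case True
        then have "e \<bullet> x = 0" using ** by simp
        then have "e = d" using e x by auto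
        then show False using True insert.prems by auto
      next
        case False
        then have "t = - (e \<bullet> x) / (e \<bullet> d)" using ** by (simp add: field_simps)
        then show False using t e by blast
      qed
    qed
    moreover have "x + t *\<^sub>R d \<in> V"
      using x insert.prems assms(2) by (intro subspace_add subspace_scale) auto
    ultimately show ?case by blast
  qed
  then show thesis using that by blast
qed

lemma card_level_eq:
  fixes f g :: "'r::finite \<Rightarrow> real"
  assumes "\<And>l. card {j. l \<le> f j} = card {j. l \<le> g j}"
  shows "card {j. f j = t} = card {j. g j = t}"
proof -
  let ?T = "insert (t + 1) {s \<in> range f \<union> range g. t < s}"
  define l where "l = Min ?T"
  have "l \<in> ?T" unfolding l_def by (rule Min_in) auto
  then have "t < l" by auto
  moreover have "l \<le> s" if "s \<in> range f \<union> range g" "t < s" for s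
    unfolding l_def using that by (intro Min_le) auto
  ultimately have "{j. f j = t} = {j. t \<le> f j} - {j. l \<le> f j}" "{j. g j = t} = {j. t \<le> g j} - {j. l \<le> g j}"
    "{j. l \<le> f j} \<subseteq> {j. t \<le> f j}" "{j. l \<le> g j} \<subseteq> {j. t \<le> g j}"
    by (force simp: le_less)+
  then show ?thesis using assms by (simp add: card_Diff_subset)
qed

lemma reindex_characters:
  fixes u v :: "'r::finite \<Rightarrow> 'a::euclidean_space"
  assumes inj: "inj u" and "\<And>j. u j \<in> span N" "\<And>j. v j \<in> span N"
    and card: "\<And>x l. x \<in> span N \<Longrightarrow> card {j. l \<le> v j \<bullet> x} = card {j. l \<le> u j \<bullet> x}"
  obtains \<tau> where "bij \<tau>" "\<And>k. v (\<tau> k) = u k"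
proof -
  let ?D = "{v j - u k | j k. True} - {0}"
  have "{v j - u k | j k. True} = (\<lambda>(j, k). v j - u k) ` UNIV" by auto
  then have "finite {v j - u k | j k. True}" by simp
  then have "finite ?D" by blast
  moreover have "?D \<subseteq> span N" using assms(2,3) span_diff by blast
  ultimately obtain x where x: "x \<in> span N" "\<And>d. d \<in> ?D \<Longrightarrow> d \<bullet> x \<noteq> 0"
    using generic_point_avoiding_hyperplanes[of ?D "span N"] by auto
  have "\<exists>j. v j = u k" for k
  proof -
    have "card {j. v j \<bullet> x = u k \<bullet> x} = card {j. u j \<bullet> x = u k \<bullet> x}"
      by (rule card_level_eq[OF card[OF x(1)]])
    moreover have "card {j. u j \<bullet> x = u k \<bullet> x} \<noteq> 0" by auto
    ultimately have "{j. v j \<bullet> x = u k \<bullet> x} \<noteq> {}" by (metis card.empty)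
    then obtain j where "v j \<bullet> x = u k \<bullet> x" by blast
    then have "v j = u k" using x(2)[of "v j - u k"] by (force simp: inner_diff_left)
    then show ?thesis ..
  qed
  then obtain \<tau> where \<tau>: "\<And>k. v (\<tau> k) = u k" by metis
  have "inj \<tau>" by (rule injI) (metis \<tau> inj injD)
  then have "bij \<tau>" by (simp add: bij_def finite_UNIV_inj_surj)
  then show thesis using that \<tau> by blast
qed

lemma connected_closed_cover_constant:
  assumes "connected X" "finite \<Delta>" "\<And>\<delta>. \<delta> \<in> \<Delta> \<Longrightarrow> closed \<delta>" "X \<subseteq> \<Union>\<Delta>"
    and agree: "\<And>\<delta> \<delta>' x. \<delta> \<in> \<Delta> \<Longrightarrow> \<delta>' \<in> \<Delta> \<Longrightarrow> x \<in> X \<Longrightarrow> x \<in> \<delta> \<Longrightarrow> x \<in> \<delta>' \<Longrightarrow> g \<delta> = g \<delta>'"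
    and x: "x \<in> X" "x \<in> \<delta>" "\<delta> \<in> \<Delta>" and y: "y \<in> X" "y \<in> \<delta>'" "\<delta>' \<in> \<Delta>"
  shows "g \<delta> = g \<delta>'"
proof (rule ccontr)
  assume ne: "g \<delta> \<noteq> g \<delta>'"
  let ?A = "\<Union>{\<tau> \<in> \<Delta>. g \<tau> = g \<delta>}" and ?B = "\<Union>{\<tau> \<in> \<Delta>. g \<tau> \<noteq> g \<delta>}"
  have "closed ?A" "closed ?B" using assms(2,3) by (auto intro!: closed_Union)
  moreover have "X \<subseteq> ?A \<union> ?B" using assms(4) by blast
  moreover have "?A \<inter> ?B \<inter> X = {}"
  proof -
    have False if "z \<in> X" "z \<in> \<tau>" "\<tau> \<in> \<Delta>" "g \<tau> = g \<delta>" "z \<in> \<tau>'" "\<tau>' \<in> \<Delta>" "g \<tau>' \<noteq> g \<delta>" for z \<tau> \<tau>'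
      using agree[OF that(3,6,1,2,5)] that by simp
    then show ?thesis by blast
  qed
  moreover have "?A \<inter> X \<noteq> {}" using x by blast
  moreover have "?B \<inter> X \<noteq> {}" using y ne[symmetric] by blast
  ultimately show False using assms(1) unfolding connected_closed by blast
qed

section \<open>The flats of a bundle with global Chern roots\<close>

lemma superlevel_local_form:
  assumes mat: "is_matroid I" and ll: "loopless I"
    and "local_form N I \<Phi> \<delta> b (char_map u)" "x \<in> \<delta>"
  shows "{e. l \<le> \<Phi> x $ e} = cl I (b ` {j. l \<le> u j \<bullet> x})"
  using assms superlevel_phi[OF mat ll, of b l "char_map u x"] by (simp add: local_form_def char_map_def)

lemma cl_ordered_basis_insert_neq:
  assumes mat: "is_matroid I" and b: "ordered_basis I b" and "i \<noteq> j" "i \<notin> A" "j \<notin> A"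
  shows "cl I (b ` insert i A) \<noteq> cl I (b ` insert j A)"
proof
  assume eq: "cl I (b ` insert i A) = cl I (b ` insert j A)"
  then have "b ` insert i (insert j A) \<subseteq> cl I (b ` insert i A)"
    using cl_superset[OF mat, of "b ` insert i A"] cl_superset[OF mat, of "b ` insert j A"] by auto
  from rk_mono[OF mat this] show False
    using assms(3-5) by (simp only: rk_cl[OF mat] rk_ordered_basis_image[OF mat b]) simp
qed

context
  fixes N :: "'a::euclidean_space set" and \<Delta> :: "'a set set" and I :: "'e::finite set set"
    and \<Phi> :: "'a \<Rightarrow> real ^ 'e" and u :: "'r::finite \<Rightarrow> 'a"
  assumes fan: "complete_fan N \<Delta>" and mat: "is_matroid I" and ll: "loopless I"
    and rank: "rk I UNIV = CARD('r)"
    and roots: "chern_roots N \<Delta> I \<Phi> u" and ind: "affinely_independent u"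
begin

lemma root_mem_span: "u j \<in> span N"
  using roots by (simp add: chern_roots_def dual_lattice_def)

lemma local_form_at:
  assumes "x \<in> span N"
  obtains \<delta> b where "\<delta> \<in> \<Delta>" "x \<in> \<delta>" "local_form N I \<Phi> \<delta> b (char_map u)"
  using assms fan roots unfolding complete_fan_def chern_roots_def by blast

lemma cone_properties: "finite \<Delta>" "\<delta> \<in> \<Delta> \<Longrightarrow> closed \<delta>" "\<delta> \<in> \<Delta> \<Longrightarrow> \<delta> \<subseteq> span N"
proof -
  have f: "finite \<Delta>" "\<forall>\<delta>\<in>\<Delta>. rational_cone N \<delta>" "\<Union>\<Delta> = span N"
    using fan by (simp_all add: complete_fan_def is_fan_def)
  show "finite \<Delta>" "\<delta> \<in> \<Delta> \<Longrightarrow> \<delta> \<subseteq> span N" using f by auto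
  assume "\<delta> \<in> \<Delta>"
  then obtain S where "finite S" "\<delta> = convex_cone hull S" using f(2) unfolding rational_cone_def by blast
  then show "closed \<delta>" using closed_convex_cone_hull by simp
qed

lemma local_flat_unique:
  assumes d: "\<delta> \<in> \<Delta>" "x \<in> \<delta>" "local_form N I \<Phi> \<delta> b (char_map u)" "\<forall>i\<in>S. \<forall>j\<in>-S. u j \<bullet> x < u i \<bullet> x"
    and d': "\<delta>' \<in> \<Delta>" "y \<in> \<delta>'" "local_form N I \<Phi> \<delta>' b' (char_map u)" "\<forall>i\<in>S. \<forall>j\<in>-S. u j \<bullet> y < u i \<bullet> y"
  shows "cl I (b ` S) = cl I (b' ` S)"
proof -
  define X where "X = span N \<inter> (\<Inter>i\<in>S. \<Inter>j\<in>-S. {x. (u i - u j) \<bullet> x > 0})"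
  have X: "x \<in> X \<longleftrightarrow> x \<in> span N \<and> (\<forall>i\<in>S. \<forall>j\<in>-S. u j \<bullet> x < u i \<bullet> x)" for x
    by (auto simp: X_def inner_diff_left)
  have "convex X" unfolding X_def
    by (intro convex_Int convex_INT convex_halfspace_gt subspace_imp_convex subspace_span)
  then have conn: "connected X" by (rule convex_connected)
  obtain B where B: "\<And>\<tau>. \<tau> \<in> \<Delta> \<Longrightarrow> local_form N I \<Phi> \<tau> (B \<tau>) (char_map u)"
    using roots unfolding chern_roots_def by metis
  have eq: "cl I (c ` S) = cl I (c' ` S)"
    if h: "x \<in> X" "x \<in> \<tau>" "x \<in> \<tau>'" "local_form N I \<Phi> \<tau> c (char_map u)" "local_form N I \<Phi> \<tau>' c' (char_map u)"
    for \<tau> \<tau>' x c c'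
  proof -
    obtain l where "S = {j. l \<le> u j \<bullet> x}"
      using superlevel_set_iff[of S "\<lambda>j. u j \<bullet> x"] X[THEN iffD1, OF h(1)] by blast
    then show ?thesis
      using superlevel_local_form[OF mat ll that(4,2), of l] superlevel_local_form[OF mat ll that(5,3), of l] by simp
  qed
  have mem: "x \<in> X" "y \<in> X" using X d d' cone_properties(3)[OF d(1)] cone_properties(3)[OF d'(1)] by auto
  have "cl I (B \<delta> ` S) = cl I (B \<delta>' ` S)"
  proof (rule connected_closed_cover_constant[OF conn cone_properties(1,2), where x = x and y = y])
    show "X \<subseteq> \<Union>\<Delta>" using X fan unfolding complete_fan_def by auto
    show "cl I (B \<tau> ` S) = cl I (B \<tau>' ` S)" if "\<tau> \<in> \<Delta>" "\<tau>' \<in> \<Delta>" "z \<in> X" "z \<in> \<tau>" "z \<in> \<tau>'" for \<tau> \<tau>' z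
      using eq[OF that(3,4,5)] B that by blast
  qed (use mem d d' in auto)
  then show ?thesis using eq[OF mem(1) d(2) d(2) d(3) B[OF d(1)]] eq[OF mem(2) d'(2) d'(2) d'(3) B[OF d'(1)]]
    by simp
qed

lemma flag_separating_point:
  assumes "S \<subseteq> T"
  obtains x where "x \<in> span N" "\<forall>i\<in>S. \<forall>j\<in>-S. u j \<bullet> x < u i \<bullet> x" "\<forall>i\<in>T. \<forall>j\<in>-T. u j \<bullet> x < u i \<bullet> x"
proof -
  obtain x c where x: "x \<in> span N" "\<And>j. u j \<bullet> x = (indicator S j + indicator T j) + c"
    using affinely_independent_values[OF ind root_mem_span, where z = "\<lambda>j. indicator S j + indicator T j"] by metis
  show thesis by (rule that[OF x(1)]) (use assms in \<open>auto simp: x(2) indicator_def\<close>)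
qed

lemma point_with_full_flag:
  assumes "full_flag W"
  obtains x where "x \<in> span N" "flag_at u x = W"
proof -
  obtain xs where xs: "distinct xs" "set xs = UNIV" "W = prefix_flag xs"
    using full_flag_obtain_enumeration[OF assms] .
  obtain z :: "real ^ 'r" where z: "inj (($) z)" "z \<in> flag_cone (prefix_flag xs)"
    using flag_cone_generic_point[OF xs(1,2)] .
  obtain x c where x: "x \<in> span N" "\<And>j. u j \<bullet> x = z $ j + c"
    using affinely_independent_values[OF ind root_mem_span] by metis
  have "sorted (map (\<lambda>j. - z $ j) xs)" using z(2) mem_flag_cone_iff_sorted[OF xs(1,2)] by blast
  then have "sorted (map (\<lambda>j. - (u j \<bullet> x)) xs)" by (simp add: x(2) sorted_iff_nth_mono_less)
  moreover have "inj (\<lambda>j. u j \<bullet> x)" using z(1) by (simp add: x(2) inj_def)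
  ultimately have "flag_at u x = W" using flag_at_eq_prefix_flag[OF xs(1,2)] xs(3) by blast
  then show thesis using that x(1) by blast
qed

definition root_flat :: "'r set \<Rightarrow> 'e set" where
  "root_flat S = (SOME F. \<exists>x \<delta> b. \<delta> \<in> \<Delta> \<and> x \<in> \<delta> \<and> local_form N I \<Phi> \<delta> b (char_map u) \<and>
     (\<forall>i\<in>S. \<forall>j\<in>-S. u j \<bullet> x < u i \<bullet> x) \<and> F = cl I (b ` S))"

lemma root_flat_eq:
  assumes "\<delta> \<in> \<Delta>" "x \<in> \<delta>" "local_form N I \<Phi> \<delta> b (char_map u)" "\<forall>i\<in>S. \<forall>j\<in>-S. u j \<bullet> x < u i \<bullet> x"
  shows "root_flat S = cl I (b ` S)"
  unfolding root_flat_def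
  by (rule some_equality) (use assms local_flat_unique[OF assms] in blast)+

lemma root_flat_basis:
  assumes "S \<subseteq> T"
  obtains b where "ordered_basis I b" "root_flat S = cl I (b ` S)" "root_flat T = cl I (b ` T)"
proof -
  obtain x where x: "x \<in> span N" "\<forall>i\<in>S. \<forall>j\<in>-S. u j \<bullet> x < u i \<bullet> x" "\<forall>i\<in>T. \<forall>j\<in>-T. u j \<bullet> x < u i \<bullet> x"
    using flag_separating_point[OF assms] .
  obtain \<delta> b where d: "\<delta> \<in> \<Delta>" "x \<in> \<delta>" "local_form N I \<Phi> \<delta> b (char_map u)" using local_form_at[OF x(1)] .
  have "ordered_basis I b" using d(3) by (simp add: local_form_def)
  then show thesis using that root_flat_eq[OF d x(2)] root_flat_eq[OF d x(3)] by blast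
qed

lemma flat_root_flat: "flat I (root_flat S)"
  using root_flat_basis[of S S] flat_cl[OF mat] by (metis subset_refl)

lemma rk_root_flat: "rk I (root_flat S) = card S"
  using root_flat_basis[of S S] rk_cl[OF mat] rk_ordered_basis_image[OF mat] by (metis subset_refl)

lemma root_flat_mono: "S \<subseteq> T \<Longrightarrow> root_flat S \<subseteq> root_flat T"
  using root_flat_basis[of S T] cl_mono[OF mat] image_mono by metis

lemma root_flat_point: "\<exists>e. root_flat {j} = cl I {e}"
proof -
  obtain b :: "'r \<Rightarrow> 'e" where "root_flat {j} = cl I (b ` {j})" by (rule root_flat_basis[OF subset_refl])
  then have "root_flat {j} = cl I {b j}" by simp
  then show ?thesis ..
qed

lemma flat_flag_eq:
  assumes "full_flag W"
  shows "flat_flag N \<Delta> I \<Phi> u W = map root_flat W"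
  unfolding flat_flag_def
proof (rule some_equality)
  have eq: "map root_flat W = basis_flag I b W"
    if "\<delta> \<in> \<Delta>" "x \<in> \<delta>" "W = flag_at u x" "local_form N I \<Phi> \<delta> b (char_map u)" for x \<delta> b
    unfolding basis_flag_def
  proof (rule map_cong[OF refl])
    fix S assume "S \<in> set W"
    then show "root_flat S = cl I (b ` S)"
      using mem_flag_at_superlevel[of S u x] that(3) root_flat_eq[OF that(1,2,4)] by simp
  qed
  obtain x where x: "x \<in> span N" "flag_at u x = W" using point_with_full_flag[OF assms] .
  obtain \<delta> b where d: "\<delta> \<in> \<Delta>" "x \<in> \<delta>" "local_form N I \<Phi> \<delta> b (char_map u)" using local_form_at[OF x(1)] .
  show "\<exists>x. \<exists>\<delta>\<in>\<Delta>. \<exists>b. x \<in> \<delta> \<and> W = flag_at u x \<and> local_form N I \<Phi> \<delta> b (char_map u) \<and>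
      map root_flat W = basis_flag I b W"
    using x(2) d eq[OF d(1,2) x(2)[symmetric] d(3)] by blast
  show "F = map root_flat W" if "\<exists>x. \<exists>\<delta>\<in>\<Delta>. \<exists>b. x \<in> \<delta> \<and> W = flag_at u x \<and>
      local_form N I \<Phi> \<delta> b (char_map u) \<and> F = basis_flag I b W" for F
    using that eq by auto
qed

text \<open>A generic point of the cone of a full flag lies in no other cone of a full flag, so if
  all maximal cones of \<open>\<Xi>\<close> coincide then all full flags are in one class.\<close>

lemma compatible_edges_connected:
  assumes "trivial_fan (Xi N \<Delta> I \<Phi> u)" "full_flag W" "full_flag W'"
  shows "(W, W') \<in> (compatible_edges I (flat_flag N \<Delta> I \<Phi> u))\<^sup>*"
proof -
  let ?E = "compatible_edges I (flat_flag N \<Delta> I \<Phi> u)"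
  obtain L where "Xi N \<Delta> I \<Phi> u = {L}" using assms(1) unfolding trivial_fan_def by blast
  then have max: "Xi_maximal_cones N \<Delta> I \<Phi> u \<subseteq> {L}" unfolding Xi_def by blast
  have L: "\<Union> (flag_cone ` {W'. (W, W') \<in> ?E\<^sup>*}) = L" if "full_flag W" for W
  proof -
    have "\<Union> (flag_cone ` {W'. (W, W') \<in> ?E\<^sup>*}) \<in> Xi_maximal_cones N \<Delta> I \<Phi> u"
      unfolding Xi_maximal_cones_def by (rule CollectI, rule exI[of _ W]) (simp add: that)
    then show ?thesis using max by (simp only: subset_iff singleton_iff)
  qed
  obtain xs where xs: "distinct xs" "set xs = UNIV" "W' = prefix_flag xs"
    using full_flag_obtain_enumeration[OF assms(3)] .
  obtain z :: "real ^ 'r" where z: "z \<in> flag_cone W'"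
    and uniq: "\<And>V. full_flag V \<Longrightarrow> z \<in> flag_cone V \<Longrightarrow> V = W'"
    using flag_cone_generic_point[OF xs(1,2)] unfolding xs(3) by metis
  have "z \<in> L" using L[OF assms(3)] z by blast
  then obtain V where V: "(W, V) \<in> ?E\<^sup>*" "z \<in> flag_cone V" using L[OF assms(2)] by blast
  from V(1) assms(2) have "full_flag V"
    by (induction rule: rtrancl_induct) (auto simp: compatible_edges_def permutohedron_edge_def)
  then show ?thesis using uniq V by blast
qed

lemma compatible_edge_swap:
  assumes x: "distinct xs" "set xs = UNIV" and y: "distinct ys" "set ys = UNIV"
    and E: "(prefix_flag xs, prefix_flag ys) \<in> compatible_edges I (flat_flag N \<Delta> I \<Phi> u)"
  shows "compatible_swap root_flat xs ys"
proof -
  obtain b where b: "permutohedron_edge (prefix_flag xs) (prefix_flag ys)" "ordered_basis I b"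
    "flat_flag N \<Delta> I \<Phi> u (prefix_flag xs) = basis_flag I b (prefix_flag xs)"
    "flat_flag N \<Delta> I \<Phi> u (prefix_flag ys) = basis_flag I b (prefix_flag ys)"
    using E unfolding compatible_edges_def by blast
  obtain p i j s where p: "xs = p @ i # j # s" "ys = p @ j # i # s"
    using permutohedron_edge_obtain_swap[OF x y b(1)] .
  have "root_flat S = cl I (b ` S)" if "S \<in> set (prefix_flag xs) \<union> set (prefix_flag ys)" for S
    using that b(3,4) flat_flag_eq full_flag_prefix_flag[OF x] full_flag_prefix_flag[OF y]
    unfolding basis_flag_def by (auto simp: map_eq_conv)
  moreover have "insert i (set p) \<in> set (prefix_flag xs)" "insert j (set p) \<in> set (prefix_flag ys)"
    using nth_mem[of "Suc (length p)" "prefix_flag xs"] nth_mem[of "Suc (length p)" "prefix_flag ys"]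
    by (auto simp: p length_prefix_flag nth_prefix_flag)
  moreover have "cl I (b ` insert i (set p)) \<noteq> cl I (b ` insert j (set p))"
    by (rule cl_ordered_basis_insert_neq[OF mat b(2)]) (use x p in auto)
  ultimately show ?thesis using p unfolding compatible_swap_def
    by (metis UnI1 UnI2)
qed

lemma all_swaps_compatible:
  assumes "trivial_fan (Xi N \<Delta> I \<Phi> u)" "j \<notin> A" "k \<notin> A" "j \<noteq> k"
  shows "root_flat (insert j A) \<noteq> root_flat (insert k A)"
proof -
  let ?E = "compatible_edges I (flat_flag N \<Delta> I \<Phi> u)"
  obtain p where p: "set p = A" "distinct p" using finite_distinct_list[of A] by auto
  obtain s where s: "set s = - insert j (insert k A)" "distinct s"
    using finite_distinct_list[of "- insert j (insert k A)"] by auto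
  let ?x = "p @ j # k # s" and ?y = "p @ k # j # s"
  have x: "distinct ?x" "set ?x = UNIV" and y: "distinct ?y" "set ?y = UNIV" using assms p s by auto
  have "(prefix_flag ?x, prefix_flag ?y) \<in> ?E\<^sup>*"
    by (rule compatible_edges_connected[OF assms(1) full_flag_prefix_flag[OF x] full_flag_prefix_flag[OF y]])
  moreover have "\<exists>ys. distinct ys \<and> set ys = UNIV \<and> V = prefix_flag ys \<and>
      (compatible_swap root_flat)\<^sup>*\<^sup>* ?x ys" if "(prefix_flag ?x, V) \<in> ?E\<^sup>*" for V
    using that
  proof (induction rule: rtrancl_induct)
    case base
    show ?case by (intro exI[of _ ?x] conjI x refl rtranclp.rtrancl_refl)
  next
    case (step V V')
    then obtain ys where ys: "distinct ys" "set ys = UNIV" "V = prefix_flag ys"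
      "(compatible_swap root_flat)\<^sup>*\<^sup>* ?x ys" by blast
    have "full_flag V'" using step.hyps(2) by (simp add: compatible_edges_def permutohedron_edge_def)
    then obtain zs where zs: "distinct zs" "set zs = UNIV" "V' = prefix_flag zs"
      using full_flag_obtain_enumeration by blast
    have "compatible_swap root_flat ys zs"
      by (rule compatible_edge_swap[OF ys(1,2) zs(1,2)]) (use step.hyps(2) ys(3) zs(3) in simp)
    with ys(4) have "(compatible_swap root_flat)\<^sup>*\<^sup>* ?x zs" by (rule rtranclp.rtrancl_into_rtrancl)
    then show ?case using zs by blast
  qed
  ultimately obtain ys where ys: "distinct ys" "prefix_flag ?y = prefix_flag ys"
    "(compatible_swap root_flat)\<^sup>*\<^sup>* ?x ys" by blast
  have "(compatible_swap root_flat)\<^sup>*\<^sup>* ?x ?y"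
    using ys(3) prefix_flag_inject[OF y(1) ys(1,2)] by simp
  from compatible_if_connected[OF mat flat_root_flat rk_root_flat root_flat_mono x this] p(1)
  show ?thesis by simp
qed

lemma trivial_bundle_if_trivial_Xi:
  assumes "trivial_fan (Xi N \<Delta> I \<Phi> u)"
  shows "trivial_bundle TYPE('r) N \<Delta> I \<Phi>"
proof -
  obtain b where b: "ordered_basis I b" and G: "\<And>S. root_flat S = cl I (b ` S)"
    using basis_if_all_compatible[OF mat flat_root_flat rk_root_flat root_flat_mono rank root_flat_point
        all_swaps_compatible[OF assms]] by metis
  have "\<Phi> x = phi I b (char_map u x)" if x: "x \<in> \<Union>\<Delta>" for x
  proof -
    obtain \<delta> c where d: "\<delta> \<in> \<Delta>" "x \<in> \<delta>" "local_form N I \<Phi> \<delta> c (char_map u)"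
      using x roots unfolding chern_roots_def by blast
    have "{e. l \<le> \<Phi> x $ e} = {e. l \<le> phi I b (char_map u x) $ e}" for l
    proof -
      let ?S = "{j. l \<le> u j \<bullet> x}"
      have "{e. l \<le> \<Phi> x $ e} = cl I (c ` ?S)" by (rule superlevel_local_form[OF mat ll d(3,2)])
      also have "\<dots> = root_flat ?S" by (rule root_flat_eq[OF d, symmetric]) auto
      also have "\<dots> = cl I (b ` ?S)" by (rule G)
      also have "\<dots> = {e. l \<le> phi I b (char_map u x) $ e}"
        using superlevel_phi[OF mat ll b, of l "char_map u x"] by (simp add: char_map_def)
      finally show ?thesis .
    qed
    then have "l \<le> \<Phi> x $ e \<longleftrightarrow> l \<le> phi I b (char_map u x) $ e" for l e by blast
    then show ?thesis by (metis antisym order_refl vec_eq_iff)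
  qed
  then show ?thesis using b roots unfolding trivial_bundle_def chern_roots_def by blast
qed

lemma global_basis_if_trivial_bundle:
  assumes "trivial_bundle TYPE('r) N \<Delta> I \<Phi>"
  obtains b :: "'r \<Rightarrow> 'e" where "ordered_basis I b" "\<And>S. root_flat S = cl I (b ` S)"
proof -
  obtain b :: "'r \<Rightarrow> 'e" and v where b: "ordered_basis I b" and v: "\<And>j. v j \<in> dual_lattice N"
    and \<Phi>: "\<And>x. x \<in> span N \<Longrightarrow> \<Phi> x = phi I b (char_map v x)"
    using assms fan unfolding trivial_bundle_def complete_fan_def by metis
  have level: "{e. l \<le> \<Phi> x $ e} = cl I (b ` {j. l \<le> v j \<bullet> x})" if "x \<in> span N" for x l
    using superlevel_phi[OF mat ll b, of l "char_map v x"] \<Phi>[OF that]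
    by (simp add: char_map_def)
  have card: "card {j. l \<le> v j \<bullet> x} = card {j. l \<le> u j \<bullet> x}" if x: "x \<in> span N" for x l
  proof -
    obtain \<delta> c where d: "\<delta> \<in> \<Delta>" "x \<in> \<delta>" "local_form N I \<Phi> \<delta> c (char_map u)" using local_form_at[OF x] .
    have c: "ordered_basis I c" using d(3) by (simp add: local_form_def)
    have "rk I (cl I (b ` {j. l \<le> v j \<bullet> x})) = rk I (cl I (c ` {j. l \<le> u j \<bullet> x}))"
      using level[OF x] superlevel_local_form[OF mat ll d(3,2)] by simp
    then show ?thesis
      by (simp add: rk_cl[OF mat] rk_ordered_basis_image[OF mat b] rk_ordered_basis_image[OF mat c])
  qed
  have "inj u" using ind by (simp add: affinely_independent_def)
  moreover have "v j \<in> span N" for j using v by (simp add: dual_lattice_def)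
  ultimately obtain \<tau> where \<tau>: "bij \<tau>" "\<And>k. v (\<tau> k) = u k"
    using reindex_characters[OF _ root_mem_span _ card] by metis
  show thesis
  proof (rule that)
    have "range (b \<circ> \<tau>) = range b" using bij_is_surj[OF \<tau>(1)] by (metis image_comp)
    then show "ordered_basis I (b \<circ> \<tau>)"
      using b bij_is_inj[OF \<tau>(1)] inj_compose unfolding ordered_basis_def by metis
    show "root_flat S = cl I ((b \<circ> \<tau>) ` S)" for S
    proof -
      obtain x where x: "x \<in> span N" "\<forall>i\<in>S. \<forall>j\<in>-S. u j \<bullet> x < u i \<bullet> x"
        using flag_separating_point[OF subset_refl] by metis
      obtain l where l: "S = {j. l \<le> u j \<bullet> x}"
        using superlevel_set_iff[of S "\<lambda>j. u j \<bullet> x"] x(2) by auto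
      obtain \<delta> c where d: "\<delta> \<in> \<Delta>" "x \<in> \<delta>" "local_form N I \<Phi> \<delta> c (char_map u)" using local_form_at[OF x(1)] .
      have "root_flat S = cl I (c ` S)" by (rule root_flat_eq[OF d x(2)])
      also have "\<dots> = cl I (b ` {j. l \<le> v j \<bullet> x})"
        using level[OF x(1), of l] superlevel_local_form[OF mat ll d(3,2), of l] l by simp
      also have "{j. l \<le> v j \<bullet> x} = \<tau> ` S"
      proof (intro equalityI subsetI)
        fix j assume j: "j \<in> {j. l \<le> v j \<bullet> x}"
        obtain k where "j = \<tau> k" using bij_is_surj[OF \<tau>(1)] by (metis surjD)
        then show "j \<in> \<tau> ` S" using j \<tau>(2) l by auto
      qed (auto simp: l \<tau>(2))
      finally show ?thesis by (simp add: image_comp)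
    qed
  qed
qed

lemma trivial_Xi_if_trivial_bundle:
  assumes "trivial_bundle TYPE('r) N \<Delta> I \<Phi>"
  shows "trivial_fan (Xi N \<Delta> I \<Phi> u)"
proof -
  let ?E = "compatible_edges I (flat_flag N \<Delta> I \<Phi> u)"
  obtain b :: "'r \<Rightarrow> 'e" where b: "ordered_basis I b" and G: "\<And>S. root_flat S = cl I (b ` S)"
    using global_basis_if_trivial_bundle[OF assms] by blast
  have flag: "flat_flag N \<Delta> I \<Phi> u W = basis_flag I b W" if "full_flag W" for W
    unfolding flat_flag_eq[OF that] basis_flag_def G ..
  have edge: "(prefix_flag xs, prefix_flag ys) \<in> ?E\<^sup>*"
    if "adjacent_swap\<^sup>*\<^sup>* xs ys" "distinct xs" "set xs = UNIV" for xs ys :: "'r list"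
    using that(1)
  proof (induction rule: rtranclp_induct)
    case (step ys zs)
    have ys: "distinct ys" "set ys = UNIV"
    proof -
      have "distinct ys \<and> set ys = UNIV" using step.hyps(1)
        by (induction rule: rtranclp_induct) (use that(2,3) in \<open>auto simp: adjacent_swap_def\<close>)
      then show "distinct ys" "set ys = UNIV" by auto
    qed
    obtain p i j s where "ys = p @ i # j # s" "zs = p @ j # i # s"
      using step.hyps(2) unfolding adjacent_swap_def by blast
    then have e: "permutohedron_edge (prefix_flag ys) (prefix_flag zs)"
      using permutohedron_edge_swap ys by simp
    then have "full_flag (prefix_flag ys)" "full_flag (prefix_flag zs)"
      unfolding permutohedron_edge_def by auto
    then have "(prefix_flag ys, prefix_flag zs) \<in> ?E"
      using e b flag unfolding compatible_edges_def by blast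
    with step.IH show ?case by (rule rtrancl.rtrancl_into_rtrancl)
  qed simp
  have conn: "(W, W') \<in> ?E\<^sup>*" if W: "full_flag W" "full_flag W'" for W W'
  proof -
    obtain xs where xs: "distinct xs" "set xs = UNIV" "W = prefix_flag xs"
      using full_flag_obtain_enumeration[OF W(1)] .
    obtain ys where ys: "distinct ys" "set ys = UNIV" "W' = prefix_flag ys"
      using full_flag_obtain_enumeration[OF W(2)] .
    have "adjacent_swap\<^sup>*\<^sup>* xs ys" by (rule adjacent_swap_connected[OF xs(1) ys(1)]) (simp add: xs(2) ys(2))
    from edge[OF this xs(1,2)] show ?thesis using xs(3) ys(3) by simp
  qed
  have "\<Union> (flag_cone ` {W'. (W, W') \<in> ?E\<^sup>*}) = UNIV" if "full_flag W" for W
    using conn[OF that] flag_cones_cover by blast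
  moreover obtain W :: "'r set list" where "full_flag W" using flag_cones_cover by blast
  ultimately have "Xi_maximal_cones N \<Delta> I \<Phi> u = {UNIV}"
    unfolding Xi_maximal_cones_def by blast
  then have "Xi N \<Delta> I \<Phi> u = {UNIV}"
    unfolding Xi_def by (auto simp: face_of_affine_eq)
  then show ?thesis unfolding trivial_fan_def using subspace_UNIV by blast
qed

end

theorem corollary1p2:
  fixes N :: "'a::euclidean_space set"
    and \<Delta> :: "'a set set"
    and I :: "'e::finite set set"
    and \<Phi> :: "'a \<Rightarrow> real ^ 'e"
    and u :: "'r::finite \<Rightarrow> 'a"
  assumes "is_lattice N"
    and "complete_fan N \<Delta>"
    and "is_matroid I" and "loopless I" and "rk I UNIV = CARD('r)"
    and "tropical_bundle TYPE('r) N \<Delta> I \<Phi>"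
    and "trivial_chern_class TYPE('r) N \<Delta> I \<Phi>"
    and "chern_roots N \<Delta> I \<Phi> u"
    and "affinely_independent u"
  shows "trivial_bundle TYPE('r) N \<Delta> I \<Phi> \<longleftrightarrow> trivial_fan (Xi N \<Delta> I \<Phi> u)"
  using trivial_bundle_if_trivial_Xi[OF assms(2-5,8,9)] trivial_Xi_if_trivial_bundle[OF assms(2-5,8,9)]
  by blast

end
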